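(* Let $L(K_{4,4})$ denote the line graph of the complete bipartite graph $K_{4,4}$. For a positive integer $n$, there exists an $L(K_{4,4})$-design of order $n$ if and only if $n \equiv 1 \pmod{96}$.
   Context: The line graph $L(K_{4,4})$ has the 16 edges of $K_{4,4}$ as its vertices. Two of these vertices are adjacent if and only if the corresponding edges share an endpoint. Equivalently, it is the $4\times 4$ rook's graph $K_4 \,\square\, K_4$, which is 6-regular with 48 edges. For simple graphs $F$ and $G$, a $G$-decomposition of $F$ is a partition of the edge set of $F$ into classes, each of which is the edge set of a subgraph of $F$ isomorphic to $G$. A $G$-design of order $n$ is a $G$-decomposition of the complete graph $K_n$; for $n=1$, the empty decomposition counts as a $G$-design. *)

theory Defs
  imports Main
begin

text \<open>Simple graphs are represented by their edge sets: sets of 2-element vertex sets.\<close>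

definition complete_graph :: "nat \<Rightarrow> nat set set" where
  "complete_graph n = {{i, j} | i j. i < n \<and> j < n \<and> i \<noteq> j}"

definition K44 :: "(nat + nat) set set" where
  "K44 = {{Inl i, Inr j} | i j. i < 4 \<and> j < 4}"

definition line_graph :: "'a set set \<Rightarrow> 'a set set set" where
  "line_graph E = {{e, f} | e f. e \<in> E \<and> f \<in> E \<and> e \<noteq> f \<and> e \<inter> f \<noteq> {}}"

definition LK44 :: "(nat + nat) set set set" where
  "LK44 = line_graph K44"

text \<open>Graph isomorphism between the graphs spanned by edge sets G and H
  (vertex sets are the unions of the edges; no isolated vertices occur here).\<close>
definition iso_edges :: "'a set set \<Rightarrow> 'b set set \<Rightarrow> bool" where
  "iso_edges G H \<longleftrightarrow> (\<exists>f. inj_on f (\<Union>G) \<and> H = (\<lambda>e. f ` e) ` G)"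

definition decomposition :: "'a set set \<Rightarrow> 'b set set \<Rightarrow> 'a set set set \<Rightarrow> bool" where
  "decomposition F G P \<longleftrightarrow>
     \<Union>P = F \<and> {} \<notin> P \<and>
     (\<forall>C\<in>P. \<forall>D\<in>P. C \<noteq> D \<longrightarrow> C \<inter> D = {}) \<and>
     (\<forall>C\<in>P. C \<subseteq> F \<and> iso_edges G C)"

definition has_design :: "'b set set \<Rightarrow> nat \<Rightarrow> bool" where
  "has_design G n \<longleftrightarrow> (\<exists>P. decomposition (complete_graph n) G P)"

end

theory Submission
  imports Defs "HOL-Library.Product_Plus" "HOL-Library.Multiset"
begin

text \<open>
  Necessity: \<open>L(K\<^sub>4\<^sub>,\<^sub>4)\<close>, the \<open>4 \<times> 4\<close> rook's graph, is 6-regular with 48 edges, so \<open>6\<close> divides \<open>n - 1\<close>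
  and \<open>96\<close> divides \<open>n(n - 1)\<close>.

  Sufficiency: write \<open>n = 96t + 1\<close>. Two pairs of parallel classes of the affine plane of order 4
  split \<open>K\<^sub>4\<^sub>,\<^sub>4\<^sub>,\<^sub>4\<^sub>,\<^sub>4\<close> into two rook's graphs. As the rook's graph is 4-colourable, a transversal design
  with four groups of size \<open>m\<close> decomposes its \<open>m\<close>-fold blow-up into rook's graphs. Hence, for suitable \<open>W\<close>,
  the \<open>W\<close>-fold blow-up of \<open>K\<^sub>4\<close> decomposes, and with it that of every graph that splits into copies of
  \<open>K\<^sub>4\<close>. Truncating one group of a transversal design with five groups of size \<open>m\<close>, giving every point
  weight 96 and adding one point at infinity yields \<open>t = 4m + s\<close> from \<open>t = m\<close> and \<open>t = s \<le> m\<close>. This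
  reduces everything to \<open>t \<le> 15\<close>, \<open>t = 26\<close> and \<open>t = 27\<close>; of these, \<open>t = 1, 2, 3, 6\<close> come from explicit
  difference families and the others from group divisible designs with block size 4.
\<close>

section \<open>Decompositions\<close>

definition decomposable :: "'b set set \<Rightarrow> 'a set set \<Rightarrow> bool" where
  "decomposable G E \<longleftrightarrow> (\<exists>P. decomposition E G P)"

definition clique :: "'a set \<Rightarrow> 'a set set" where
  "clique V = {{u, v} | u v. u \<in> V \<and> v \<in> V \<and> u \<noteq> v}"

lemma cliqueI: "u \<in> V \<Longrightarrow> v \<in> V \<Longrightarrow> u \<noteq> v \<Longrightarrow> {u, v} \<in> clique V"
  unfolding clique_def by blast

lemma cliqueE:
  assumes "e \<in> clique V"
  obtains u v where "e = {u, v}" "u \<in> V" "v \<in> V" "u \<noteq> v"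
  using assms unfolding clique_def by blast

lemma clique_subset: "e \<in> clique V \<Longrightarrow> e \<subseteq> V"
  unfolding clique_def by blast

lemma clique_mono: "U \<subseteq> V \<Longrightarrow> clique U \<subseteq> clique V"
  unfolding clique_def by blast

lemma iso_edges_trans:
  assumes "iso_edges G H" "iso_edges H K"
  shows "iso_edges G K"
proof -
  obtain f where f: "inj_on f (\<Union>G)" "H = (\<lambda>e. f ` e) ` G"
    using assms(1) unfolding iso_edges_def by blast
  obtain g where g: "inj_on g (\<Union>H)" "K = (\<lambda>e. g ` e) ` H"
    using assms(2) unfolding iso_edges_def by blast
  have "\<Union>H = f ` \<Union>G" using f(2) by auto
  then have "inj_on (g \<circ> f) (\<Union>G)" using f(1) g(1) by (simp add: comp_inj_on)
  moreover have "K = (\<lambda>e. (g \<circ> f) ` e) ` G" using f(2) g(2) by (simp add: image_image)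
  ultimately show ?thesis unfolding iso_edges_def by blast
qed

lemma iso_edges_sym:
  assumes "iso_edges G H"
  shows "iso_edges H G"
proof -
  obtain f where f: "inj_on f (\<Union>G)" "H = (\<lambda>e. f ` e) ` G"
    using assms unfolding iso_edges_def by blast
  let ?g = "inv_into (\<Union>G) f"
  have U: "\<Union>H = f ` \<Union>G" using f(2) by auto
  have "inj_on ?g (\<Union>H)" unfolding U by (rule inj_on_inv_into) simp
  moreover have "?g ` f ` e = e" if "e \<in> G" for e
    using that f(1) by (intro inv_into_image_cancel) auto
  then have "G = (\<lambda>e. ?g ` e) ` H" using f(2) by (simp add: image_image)
  ultimately show ?thesis unfolding iso_edges_def by blast
qed

lemma decomposable_empty: "decomposable G {}"
  unfolding decomposable_def decomposition_def by (rule exI[of _ "{}"]) simp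

lemma decomposable_iso_self:
  assumes "iso_edges G C"
  shows "decomposable G C"
\<comment> \<open>The one-class partition is barred for empty \<open>C\<close>, since classes must
  be nonempty; there the empty partition serves.\<close>
proof (cases "C = {}")
  case False
  then have "decomposition C G {C}" using assms unfolding decomposition_def by auto
  then show ?thesis unfolding decomposable_def by blast
qed (simp add: decomposable_empty)

lemma decomposable_Union:
  assumes "\<And>F. F \<in> \<F> \<Longrightarrow> decomposable G F"
    and "\<And>F F'. F \<in> \<F> \<Longrightarrow> F' \<in> \<F> \<Longrightarrow> F \<noteq> F' \<Longrightarrow> F \<inter> F' = {}"
  shows "decomposable G (\<Union>\<F>)"
proof -
  obtain P where P: "\<And>F. F \<in> \<F> \<Longrightarrow> decomposition F G (P F)"
    using assms(1) unfolding decomposable_def by metis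
  have U: "\<Union>(P F) = F" and ne: "{} \<notin> P F"
    and disj: "\<And>C D. C \<in> P F \<Longrightarrow> D \<in> P F \<Longrightarrow> C \<noteq> D \<Longrightarrow> C \<inter> D = {}"
    and iso: "\<And>C. C \<in> P F \<Longrightarrow> iso_edges G C" if "F \<in> \<F>" for F
    using P[OF that] unfolding decomposition_def by simp_all
  have "decomposition (\<Union>\<F>) G (\<Union>F\<in>\<F>. P F)"
    unfolding decomposition_def
  proof (intro conjI ballI impI)
    show U': "\<Union> (\<Union> (P ` \<F>)) = \<Union> \<F>"
    proof -
      have "\<Union> (\<Union> (P ` \<F>)) = (\<Union>F\<in>\<F>. \<Union>(P F))" by blast
      then show ?thesis using U by simp
    qed
    show "{} \<notin> \<Union> (P ` \<F>)" using ne by blast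
    show "C \<subseteq> \<Union>\<F>" if "C \<in> \<Union> (P ` \<F>)" for C
      unfolding U'[symmetric] using that by (rule Union_upper)
    show "iso_edges G C" if "C \<in> \<Union> (P ` \<F>)" for C
      using that iso by blast
  next
    fix C D assume *: "C \<in> \<Union> (P ` \<F>)" "D \<in> \<Union> (P ` \<F>)" "C \<noteq> D"
    then obtain F F' where F: "F \<in> \<F>" "C \<in> P F" "F' \<in> \<F>" "D \<in> P F'" by blast
    show "C \<inter> D = {}"
    proof (cases "F = F'")
      case True
      then show ?thesis using F disj[of F C D] * by simp
    next
      case False
      have "C \<subseteq> F" "D \<subseteq> F'" using U[OF F(1)] U[OF F(3)] F by blast+
      then show ?thesis using assms(2)[OF F(1,3) False] by blast
    qed
  qed
  then show ?thesis unfolding decomposable_def by blast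
qed

lemma decomposable_Un:
  assumes "decomposable G E" "decomposable G F" "E \<inter> F = {}"
  shows "decomposable G (E \<union> F)"
proof -
  have "decomposable G (\<Union>{E, F})" by (rule decomposable_Union) (use assms in auto)
  then show ?thesis by simp
qed

lemma decomposable_iso:
  assumes "decomposable H G" "iso_edges G C"
  shows "decomposable H C"
proof -
  obtain P where P: "decomposition G H P" using assms(1) unfolding decomposable_def by blast
  obtain f where f: "inj_on f (\<Union>G)" "C = (\<lambda>e. f ` e) ` G"
    using assms(2) unfolding iso_edges_def by blast
  let ?h = "\<lambda>e. f ` e"
  have inj: "inj_on ?h G" using inj_on_image_Pow[OF f(1)] by (rule inj_on_subset) blast
  have PG: "\<And>D. D \<in> P \<Longrightarrow> D \<subseteq> G" using P unfolding decomposition_def by blast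
  have "C = \<Union> ((\<lambda>D. ?h ` D) ` P)"
    using P f(2) unfolding decomposition_def by blast
  moreover have "decomposable H (\<Union> ((\<lambda>D. ?h ` D) ` P))"
  proof (rule decomposable_Union)
    fix F assume "F \<in> (\<lambda>D. ?h ` D) ` P"
    then obtain D where D: "D \<in> P" "F = ?h ` D" by blast
    have "iso_edges D F" unfolding iso_edges_def
      using D PG[of D] f(1) by (intro exI[of _ f]) (auto intro: inj_on_subset)
    then show "decomposable H F"
      using D P unfolding decomposition_def by (metis decomposable_iso_self iso_edges_trans)
  next
    fix F F' assume "F \<in> (\<lambda>D. ?h ` D) ` P" "F' \<in> (\<lambda>D. ?h ` D) ` P" "F \<noteq> F'"
    then obtain D D' where D: "D \<in> P" "F = ?h ` D" "D' \<in> P" "F' = ?h ` D'" "D \<noteq> D'" by blast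
    then have "D \<inter> D' = {}" using P unfolding decomposition_def by blast
    then show "F \<inter> F' = {}"
      using D PG inj by (metis image_empty inj_on_image_Int)
  qed
  ultimately show ?thesis by simp
qed

lemma decomposable_trans:
  assumes "decomposable H G" "decomposable G E"
  shows "decomposable H E"
proof -
  obtain P where P: "decomposition E G P" using assms(2) unfolding decomposable_def by blast
  have "decomposable H (\<Union>P)"
  proof (rule decomposable_Union)
    show "decomposable H C" if "C \<in> P" for C
      using P that unfolding decomposition_def by (intro decomposable_iso[OF assms(1)]) simp
  qed (use P in \<open>simp add: decomposition_def\<close>)
  then show ?thesis using P unfolding decomposition_def by simp
qed

text \<open>Surjectivity puts every edge of \<open>E\<close> into some copy of \<open>G\<close>, and
  injectivity keeps different copies edge-disjoint. All decompositions given by indexed embeddings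
  go through this criterion.\<close>

lemma decomposableI:
  assumes inj: "\<And>i. i \<in> I \<Longrightarrow> inj_on (f i) (\<Union>G)"
    and bij: "bij_betw (\<lambda>(i, e). f i ` e) (I \<times> G) E"
  shows "decomposable G E"
proof -
  let ?C = "\<lambda>i. (\<lambda>e. f i ` e) ` G"
  have "E = \<Union> (?C ` I)" using bij_betw_imp_surj_on[OF bij] by auto
  moreover have "decomposable G (\<Union> (?C ` I))"
  proof (rule decomposable_Union)
    fix F assume "F \<in> ?C ` I"
    then show "decomposable G F"
      using inj decomposable_iso_self unfolding iso_edges_def by blast
  next
    fix F F' assume "F \<in> ?C ` I" "F' \<in> ?C ` I" "F \<noteq> F'"
    then obtain i j where "i \<in> I" "j \<in> I" "F = ?C i" "F' = ?C j" "i \<noteq> j" by blast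
    moreover have False if "a \<in> G" "b \<in> G" "f i ` a = f j ` b" for a b
      using inj_onD[OF bij_betw_imp_inj_on[OF bij], of "(i, a)" "(j, b)"] that calculation by simp
    ultimately show "F \<inter> F' = {}" by blast
  qed
  ultimately show ?thesis by simp
qed

text \<open>Working with ordered pairs turns the covering condition into a bijection
  that can be checked on differences or on explicit lists.\<close>

lemma decomposable_arcsI:
  assumes sym: "\<And>p q. (p, q) \<in> A \<Longrightarrow> (q, p) \<in> A"
    and inj: "\<And>i. i \<in> I \<Longrightarrow> inj_on (b i) (fst ` A)"
    and bij: "bij_betw (\<lambda>(i, p, q). (b i p, b i q)) (I \<times> A) F"
  shows "decomposable {{p, q} | p q. (p, q) \<in> A} {{x, y} | x y. (x, y) \<in> F}"
    (is "decomposable ?G ?E")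
proof (rule decomposableI)
  have "\<Union>?G \<subseteq> fst ` A" using sym by force
  then show "inj_on (b i) (\<Union>?G)" if "i \<in> I" for i
    using inj[OF that] by (rule inj_on_subset[rotated])
  have injF: "inj_on (\<lambda>(i, p, q). (b i p, b i q)) (I \<times> A)"
    and imF: "(\<lambda>(i, p, q). (b i p, b i q)) ` (I \<times> A) = F"
    using bij unfolding bij_betw_def by auto
  show "bij_betw (\<lambda>(i, e). b i ` e) (I \<times> ?G) ?E"
    unfolding bij_betw_def
  proof
    show "inj_on (\<lambda>(i, e). b i ` e) (I \<times> ?G)"
    proof (rule inj_onI)
      fix x y assume "x \<in> I \<times> ?G" "y \<in> I \<times> ?G"
        and eq: "(case x of (i, e) \<Rightarrow> b i ` e) = (case y of (i, e) \<Rightarrow> b i ` e)"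
      then obtain i p q j p' q' where x: "x = (i, {p, q})" "i \<in> I" "(p, q) \<in> A"
        and y: "y = (j, {p', q'})" "j \<in> I" "(p', q') \<in> A" by auto
      from eq have "{b i p, b i q} = {b j p', b j q'}" using x y by simp
      \<comment> \<open>Each edge carries two arcs; if the orientations disagree, symmetry of
        \<open>A\<close> allows one arc to be reversed before injectivity on arcs is
        applied.\<close>
      then consider "b i p = b j p'" "b i q = b j q'" | "b i p = b j q'" "b i q = b j p'"
        by (auto simp: doubleton_eq_iff)
      then show "x = y"
      proof cases
        case 1
        then have "(i, p, q) = (j, p', q')" using x y by (intro inj_onD[OF injF]) auto
        then show ?thesis using x y by simp
      next
        case 2
        then have "(i, p, q) = (j, q', p')" using x y sym by (intro inj_onD[OF injF]) auto
        then show ?thesis using x y by (simp add: insert_commute)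
      qed
    qed
    show "(\<lambda>(i, e). b i ` e) ` (I \<times> ?G) = ?E"
    proof (intro equalityI subsetI)
      fix e assume "e \<in> (\<lambda>(i, e). b i ` e) ` (I \<times> ?G)"
      then obtain i p q where "i \<in> I" "(p, q) \<in> A" "e = {b i p, b i q}" by auto
      moreover have "(b i p, b i q) \<in> F" using imF calculation by force
      ultimately show "e \<in> ?E" by blast
    next
      fix e assume "e \<in> ?E"
      then obtain x y where xy: "e = {x, y}" "(x, y) \<in> F" by blast
      then obtain i p q where "i \<in> I" "(p, q) \<in> A" "x = b i p" "y = b i q"
        unfolding imF[symmetric] by auto
      then show "e \<in> (\<lambda>(i, e). b i ` e) ` (I \<times> ?G)"
        using xy by (intro image_eqI[of _ _ "(i, {p, q})"]) auto
    qed
  qed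
qed

lemma clique_iso:
  assumes "finite A" "finite B" "card A = card B"
  shows "iso_edges (clique A) (clique B)"
proof -
  obtain h where h: "bij_betw h A B" using finite_same_card_bij[OF assms] by blast
  \<comment> \<open>Only an inclusion: a one-point set spans no edge, so its point is missing on the
    left.\<close>
  have sub: "\<Union>(clique A) \<subseteq> A" unfolding clique_def by auto
  have "clique B = (\<lambda>e. h ` e) ` clique A"
  proof (intro equalityI subsetI)
    fix e assume "e \<in> clique B"
    then obtain u v where "e = {u, v}" "u \<in> B" "v \<in> B" "u \<noteq> v" unfolding clique_def by auto
    moreover then obtain u' v' where "u' \<in> A" "v' \<in> A" "u = h u'" "v = h v'"
      using h unfolding bij_betw_def by blast
    ultimately have "e = h ` {u', v'}" "{u', v'} \<in> clique A" unfolding clique_def by auto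
    then show "e \<in> (\<lambda>e. h ` e) ` clique A" by blast
  next
    fix e assume "e \<in> (\<lambda>e. h ` e) ` clique A"
    then obtain u v where e: "e = {h u, h v}" "u \<in> A" "v \<in> A" "u \<noteq> v" unfolding clique_def by auto
    then have "h u \<noteq> h v" "h u \<in> B" "h v \<in> B"
      using h unfolding bij_betw_def inj_on_def by auto
    then show "e \<in> clique B" unfolding clique_def using e by blast
  qed
  then show ?thesis unfolding iso_edges_def
    using h sub unfolding bij_betw_def by (meson inj_on_subset)
qed

section \<open>Blow-ups\<close>

text \<open>This is the lexicographic product of \<open>E\<close> with the edgeless graph on
  \<open>m\<close> vertices. The clause \<open>u \<noteq> v\<close> keeps a singleton in
  \<open>E\<close> from creating edges inside one fibre.\<close>

definition blow :: "nat \<Rightarrow> 'a set set \<Rightarrow> ('a \<times> nat) set set" where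
  "blow m E = {{(u, a), (v, b)} | u v a b. {u, v} \<in> E \<and> u \<noteq> v \<and> a < m \<and> b < m}"

lemma blowI:
  "{u, v} \<in> E \<Longrightarrow> u \<noteq> v \<Longrightarrow> a < m \<Longrightarrow> b < m \<Longrightarrow> {(u, a), (v, b)} \<in> blow m E"
  unfolding blow_def by blast

lemma blowE:
  assumes "e \<in> blow m E"
  obtains u v a b where "e = {(u, a), (v, b)}" "{u, v} \<in> E" "u \<noteq> v" "a < m" "b < m"
  using assms unfolding blow_def by blast

lemma blow_iso:
  assumes "iso_edges G C"
  shows "iso_edges (blow m G) (blow m C)"
proof -
  obtain f where f: "inj_on f (\<Union>G)" "C = (\<lambda>e. f ` e) ` G"
    using assms unfolding iso_edges_def by blast
  let ?g = "map_prod f id :: _ \<times> nat \<Rightarrow> _"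
  have "\<Union>(blow m G) \<subseteq> \<Union>G \<times> UNIV" unfolding blow_def by auto
  moreover have "inj_on ?g (\<Union>G \<times> UNIV)" using f(1) by (auto simp: inj_on_def)
  ultimately have "inj_on ?g (\<Union>(blow m G))" by (rule inj_on_subset[rotated])
  moreover have "blow m C = (\<lambda>e. ?g ` e) ` blow m G"
  proof (intro equalityI subsetI)
    fix e assume "e \<in> blow m C"
    then obtain u v a b where e: "e = {(u, a), (v, b)}" "{u, v} \<in> C" "u \<noteq> v" "a < m" "b < m"
      unfolding blow_def by auto
    then obtain d where d: "d \<in> G" "{u, v} = f ` d" using f(2) by auto
    then obtain u' v' where uv: "u' \<in> d" "v' \<in> d" "u = f u'" "v = f v'" by blast
    \<comment> \<open>Injectivity of \<open>f\<close> on the vertices forbids a third element of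
      \<open>d\<close>, whose image would have to be \<open>u\<close> or \<open>v\<close>.\<close>
    have "d = {u', v'}"
    proof -
      have "x = u' \<or> x = v'" if "x \<in> d" for x
      proof -
        have "f x = f u' \<or> f x = f v'" using d(2) uv that by blast
        then show ?thesis using f(1) d(1) uv that unfolding inj_on_def by blast
      qed
      then show ?thesis using uv by blast
    qed
    then have "{(u', a), (v', b)} \<in> blow m G" unfolding blow_def using d e uv by blast
    moreover have "e = ?g ` {(u', a), (v', b)}" using e uv by simp
    ultimately show "e \<in> (\<lambda>e. ?g ` e) ` blow m G" by blast
  next
    fix e assume "e \<in> (\<lambda>e. ?g ` e) ` blow m G"
    then obtain u v a b where e: "e = {(f u, a), (f v, b)}" "{u, v} \<in> G" "u \<noteq> v" "a < m" "b < m"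
      unfolding blow_def by auto
    then have "f u \<noteq> f v" using f(1) unfolding inj_on_def by blast
    moreover have "f ` {u, v} \<in> C" unfolding f(2) using e(2) by (rule imageI)
    ultimately show "e \<in> blow m C" using e by (auto intro: blowI)
  qed
  ultimately show ?thesis unfolding iso_edges_def by blast
qed

text \<open>Projection recovers the original edge, so blow-ups of edge-disjoint graphs are
  edge-disjoint.\<close>

lemma fst_image_blow: "e \<in> blow m E \<Longrightarrow> fst ` e \<in> E"
  unfolding blow_def by auto

lemma decomposable_blow:
  assumes "decomposable G E"
  shows "decomposable (blow m G) (blow m E)"
proof -
  obtain P where P: "decomposition E G P" using assms unfolding decomposable_def by blast
  have "blow m (\<Union>P) = \<Union> (blow m ` P)" unfolding blow_def by blast
  then have "blow m E = \<Union> (blow m ` P)" using P unfolding decomposition_def by simp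
  moreover have "decomposable (blow m G) (\<Union> (blow m ` P))"
  proof (rule decomposable_Union)
    fix F assume "F \<in> blow m ` P"
    then obtain C where "C \<in> P" "F = blow m C" by blast
    moreover then have "iso_edges G C" using P unfolding decomposition_def by simp
    ultimately show "decomposable (blow m G) F" by (simp add: blow_iso decomposable_iso_self)
  next
    fix F F' assume "F \<in> blow m ` P" "F' \<in> blow m ` P" "F \<noteq> F'"
    then obtain C D where C: "C \<in> P" "D \<in> P" "F = blow m C" "F' = blow m D" "C \<noteq> D" by blast
    then have "C \<inter> D = {}" using P unfolding decomposition_def by blast
    then show "F \<inter> F' = {}" using fst_image_blow C by (metis disjoint_iff)
  qed
  ultimately show ?thesis by simp
qed

text \<open>A fibre index below \<open>b * a\<close> is read as \<open>x * a + y\<close> with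
  \<open>y < a\<close>; quotient and remainder by \<open>a\<close> give the inverse.\<close>

lemma blow_blow_iso: "iso_edges (blow a (blow b E)) (blow (b * a) E)"
proof -
  let ?g = "\<lambda>((v, x), y). (v, x * a + y)"
  have "inj_on ?g (\<Union>(blow a (blow b E)))"
  proof (rule inj_onI)
    fix p q assume p: "p \<in> \<Union>(blow a (blow b E))" and q: "q \<in> \<Union>(blow a (blow b E))"
      and eq: "?g p = ?g q"
    obtain v x y where pv: "p = ((v, x), y)" by (metis surj_pair)
    obtain w x' y' where qw: "q = ((w, x'), y')" by (metis surj_pair)
    have "y < a" "y' < a" using p q pv qw unfolding blow_def by auto
    moreover have "x * a + y = x' * a + y'" "v = w" using eq pv qw by auto
    ultimately have "x = x'" "y = y'"
      by (metis add.commute div_mult_self3 div_less gr_implies_not0 add.right_neutral,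
          metis mod_mult_self3 mod_less)
    then show "p = q" using pv qw \<open>v = w\<close> by simp
  qed
  moreover have "blow (b * a) E = (\<lambda>e. ?g ` e) ` blow a (blow b E)"
  proof (intro equalityI subsetI)
    fix e assume "e \<in> blow (b * a) E"
    then obtain u v i j where e: "e = {(u, i), (v, j)}" "{u, v} \<in> E" "u \<noteq> v" "i < b * a" "j < b * a"
      unfolding blow_def by auto
    have a: "a > 0" using e(4) by (cases a) auto
    have "{(u, i div a), (v, j div a)} \<in> blow b E"
      using e by (intro blowI) (auto simp: less_mult_imp_div_less)
    then have "{((u, i div a), i mod a), ((v, j div a), j mod a)} \<in> blow a (blow b E)"
      by (rule blowI) (use e(3) a in auto)
    moreover have "e = ?g ` {((u, i div a), i mod a), ((v, j div a), j mod a)}"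
      using e(1) by simp
    ultimately show "e \<in> (\<lambda>e. ?g ` e) ` blow a (blow b E)" by blast
  next
    fix e assume "e \<in> (\<lambda>e. ?g ` e) ` blow a (blow b E)"
    then obtain d where d: "d \<in> blow a (blow b E)" "e = ?g ` d" by blast
    from d(1) obtain p q i j where e': "d = {(p, i), (q, j)}" "{p, q} \<in> blow b E" "i < a" "j < a"
      by (rule blowE)
    then have e: "e = ?g ` {(p, i), (q, j)}" "i < a" "j < a" using d by simp_all
    from e'(2) obtain u v x y
      where uv: "{p, q} = {(u, x), (v, y)}" "{u, v} \<in> E" "u \<noteq> v" "x < b" "y < b"
      by (rule blowE)
    have bound: "x * a + i < b * a" if "x < b" "i < a" for x i
    proof -
      have "x * a + i < Suc x * a" using that by simp
      also have "\<dots> \<le> b * a" using that by (intro mult_le_mono1) simp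
      finally show ?thesis .
    qed
    from uv(1) consider "p = (u, x)" "q = (v, y)" | "p = (v, y)" "q = (u, x)"
      by (auto simp: doubleton_eq_iff)
    then show "e \<in> blow (b * a) E"
    proof cases
      case 1
      then have "e = {(u, x * a + i), (v, y * a + j)}" using e(1) by simp
      then show ?thesis using uv e(2,3) bound by (auto intro: blowI)
    next
      case 2
      then have "e = {(u, x * a + j), (v, y * a + i)}" using e(1) by auto
      then show ?thesis using uv e(2,3) bound by (auto intro: blowI)
    qed
  qed
  ultimately show ?thesis unfolding iso_edges_def by blast
qed

text \<open>A point \<open>None\<close> at infinity is adjoined to the weighted points of
  \<open>V\<close>. Edges between groups are covered by the blow-up, and each group together with
  \<open>None\<close> spans a clique of the order supplied by \<open>groups\<close>; any two of
  these cliques share only the vertex \<open>None\<close>.\<close>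

lemma decomposable_fill:
  fixes V :: "'a set" and g :: "'a \<Rightarrow> 'i"
  assumes fin: "finite V"
    and cross: "decomposable G (blow W {{p, q} | p q. p \<in> V \<and> q \<in> V \<and> g p \<noteq> g q})"
    and groups: "\<And>i. i \<in> g ` V \<Longrightarrow> decomposable G (clique {..<W * card {p \<in> V. g p = i} + 1})"
  shows "decomposable G (clique {..<W * card V + 1})"
proof -
  let ?X = "\<lambda>U. insert None (Some ` (U \<times> {..<W}))"
  let ?C = "{{p, q} | p q. p \<in> V \<and> q \<in> V \<and> g p \<noteq> g q}"
  define B where "B = (\<lambda>e. Some ` e) ` blow W ?C"
  define F where "F = (\<lambda>i. clique (?X {p \<in> V. g p = i}))"
  have card: "card (?X U) = W * card U + 1" if "finite U" for U :: "'a set"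
  proof -
    have "card (?X U) = Suc (card (Some ` (U \<times> {..<W})))"
      using that by (intro card_insert_disjoint) auto
    also have "card (Some ` (U \<times> {..<W})) = card (U \<times> {..<W})" by (rule card_image) simp
    finally show ?thesis by (simp add: card_cartesian_product)
  qed
  have cl: "iso_edges (clique {..<W * card U + 1}) (clique (?X U))" if "finite U" for U :: "'a set"
    using that card[OF that] by (intro clique_iso) auto
  have B_iff: "e \<in> B \<longleftrightarrow> (\<exists>p q a b. e = {Some (p, a), Some (q, b)} \<and> p \<in> V \<and> q \<in> V \<and> g p \<noteq> g q
      \<and> a < W \<and> b < W)" (is "_ \<longleftrightarrow> ?R e") for e
  proof
    assume "e \<in> B"
    then obtain d where "d \<in> blow W ?C" "e = Some ` d" unfolding B_def by blast
    then obtain p q a b where "e = {Some (p, a), Some (q, b)}" "{p, q} \<in> ?C" "a < W" "b < W"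
      by (elim blowE) (metis (no_types, lifting) image_empty image_insert)
    moreover have "p \<in> V \<and> q \<in> V \<and> g p \<noteq> g q" using \<open>{p, q} \<in> ?C\<close> by (auto simp: doubleton_eq_iff)
    ultimately show "?R e" by blast
  next
    assume "?R e"
    then obtain p q a b where *: "e = {Some (p, a), Some (q, b)}" "p \<in> V" "q \<in> V" "g p \<noteq> g q"
      "a < W" "b < W" by blast
    then have "{(p, a), (q, b)} \<in> blow W ?C" by (intro blowI) auto
    then show "e \<in> B" unfolding B_def using *(1) by (intro image_eqI[of _ _ "{(p, a), (q, b)}"]) auto
  qed
  have decB: "decomposable G B"
  proof (rule decomposable_iso[OF cross])
    show "iso_edges (blow W ?C) B" unfolding iso_edges_def B_def by (rule exI[of _ Some]) simp
  qed
  have decF: "decomposable G (\<Union> (F ` g ` V))"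
  proof (rule decomposable_Union)
    fix E assume "E \<in> F ` g ` V"
    then obtain i where i: "i \<in> g ` V" "E = F i" by blast
    show "decomposable G E" unfolding i(2) F_def by (rule decomposable_iso[OF groups[OF i(1)] cl]) (use fin in simp)
  next
    fix E E' assume "E \<in> F ` g ` V" "E' \<in> F ` g ` V" "E \<noteq> E'"
    moreover then obtain i j where "E = F i" "E' = F j" by (elim imageE) simp
    ultimately have ij: "E = F i" "E' = F j" "i \<noteq> j" by auto
    show "E \<inter> E' = {}"
    proof (rule ccontr)
      assume "E \<inter> E' \<noteq> {}"
      then obtain e where e: "e \<in> F i" "e \<in> F j" using ij by blast
      obtain u v where uv: "e = {u, v}" "u \<noteq> v" using e(1) unfolding F_def by (rule cliqueE)
      \<comment> \<open>An edge has at most one endpoint at infinity, and any other endpoint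
        identifies the group.\<close>
      then obtain p where p: "Some p \<in> e" by (cases u; cases v) auto
      have "g (fst p) = i" "g (fst p) = j" using e[unfolded F_def, THEN clique_subset] p by auto
      then show False using ij by simp
    qed
  qed
  have disj: "B \<inter> \<Union> (F ` g ` V) = {}"
  proof (rule ccontr)
    assume "B \<inter> \<Union> (F ` g ` V) \<noteq> {}"
    then obtain e i where e: "e \<in> B" "e \<in> F i" by blast
    from e(1) obtain p q a b where "e = {Some (p, a), Some (q, b)}" "g p \<noteq> g q" unfolding B_iff by blast
    moreover have "g p = i" "g q = i" if "e = {Some (p, a), Some (q, b)}"
      using clique_subset[OF e(2)[unfolded F_def]] that by auto
    ultimately show False by metis
  qed
  have "clique (?X V) = B \<union> \<Union> (F ` g ` V)"
  proof (intro equalityI subsetI)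
    fix e assume "e \<in> clique (?X V)"
    then obtain u v where e: "e = {u, v}" "u \<in> ?X V" "v \<in> ?X V" "u \<noteq> v" by (rule cliqueE)
    have one: "{Some (p, a), None} \<in> F (g p)" if "p \<in> V" "a < W" for p a
      unfolding F_def by (rule cliqueI) (use that in auto)
    show "e \<in> B \<union> \<Union> (F ` g ` V)"
    proof (cases "u = None \<or> v = None")
      case True
      then obtain p a where "e = {Some (p, a), None}" "p \<in> V" "a < W" using e by auto
      then show ?thesis using one by blast
    next
      case False
      then obtain p a q b where pq: "u = Some (p, a)" "v = Some (q, b)" "p \<in> V" "q \<in> V" "a < W" "b < W"
        using e by auto
      show ?thesis
      proof (cases "g p = g q")
        case True
        then have "e \<in> F (g p)" unfolding e(1) F_def by (intro cliqueI) (use e pq in auto)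
        then show ?thesis using pq by blast
      next
        case False
        then have "e \<in> B" unfolding B_iff using e pq by blast
        then show ?thesis by blast
      qed
    qed
  next
    fix e assume "e \<in> B \<union> \<Union> (F ` g ` V)"
    then show "e \<in> clique (?X V)"
    proof
      assume "e \<in> B"
      then obtain p q a b where "e = {Some (p, a), Some (q, b)}" "p \<in> V" "q \<in> V" "g p \<noteq> g q"
        "a < W" "b < W" unfolding B_iff by blast
      then show ?thesis by (auto intro!: cliqueI)
    next
      assume "e \<in> \<Union> (F ` g ` V)"
      then obtain i where "e \<in> F i" by blast
      moreover have "F i \<subseteq> clique (?X V)" unfolding F_def by (rule clique_mono) auto
      ultimately show ?thesis by blast
    qed
  qed
  then have "decomposable G (clique (?X V))" using decomposable_Un[OF decB decF disj] by simp
  then show ?thesis using cl[OF fin] decomposable_iso iso_edges_sym by blast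
qed

section \<open>Transversal designs\<close>

text \<open>Blocks are indexed by pairs \<open>(x, y)\<close>; the block meets group \<open>j\<close> in the point \<open>f j x y\<close>.\<close>

definition transversal_design :: "nat \<Rightarrow> nat \<Rightarrow> (nat \<Rightarrow> nat \<Rightarrow> nat \<Rightarrow> nat) \<Rightarrow> bool" where
  "transversal_design k m f \<longleftrightarrow>
     (\<forall>j<k. \<forall>x<m. \<forall>y<m. f j x y < m) \<and>
     (\<forall>i<k. \<forall>j<i. inj_on (\<lambda>(x, y). (f i x y, f j x y)) ({..<m} \<times> {..<m}))"

lemma transversal_design_less:
  "transversal_design k m f \<Longrightarrow> j < k \<Longrightarrow> x < m \<Longrightarrow> y < m \<Longrightarrow> f j x y < m"
  unfolding transversal_design_def by blast

text \<open>An injection of the finite square of index pairs into itself is onto. Two points from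
  different groups thus lie on exactly one common block.\<close>

lemma transversal_design_bij:
  assumes td: "transversal_design k m f" and ij: "i < k" "j < k" "i \<noteq> j"
  shows "bij_betw (\<lambda>(x, y). (f i x y, f j x y)) ({..<m} \<times> {..<m}) ({..<m} \<times> {..<m})"
proof -
  have "inj_on (\<lambda>(x, y). (f i x y, f j x y)) ({..<m} \<times> {..<m})"
  proof (cases "j < i")
    case True
    then show ?thesis using td ij unfolding transversal_design_def by blast
  next
    case False
    then have "inj_on (\<lambda>(x, y). (f j x y, f i x y)) ({..<m} \<times> {..<m})"
      using td ij unfolding transversal_design_def by auto
    then show ?thesis unfolding inj_on_def by auto
  qed
  moreover have "(\<lambda>(x, y). (f i x y, f j x y)) ` ({..<m} \<times> {..<m}) \<subseteq> {..<m} \<times> {..<m}"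
    using td ij by (auto intro: transversal_design_less)
  ultimately show ?thesis
    unfolding bij_betw_def by (simp add: endo_inj_surj)
qed

lemma transversal_design_mono:
  "transversal_design k m f \<Longrightarrow> l \<le> k \<Longrightarrow> transversal_design l m f"
  unfolding transversal_design_def by simp

text \<open>Two columns with positive indices differ by \<open>(i - j) * y\<close> modulo
  \<open>m\<close>, where \<open>0 < i - j < k - 1\<close> makes the factor invertible; hence they
  determine \<open>y\<close> and then \<open>x\<close>. Column 0 gives \<open>y\<close>
  directly.\<close>

lemma transversal_design_linear:
  assumes cop: "\<And>d. 0 < d \<Longrightarrow> d < k - 1 \<Longrightarrow> coprime d m" and "m > 0"
  shows "transversal_design k m (\<lambda>j x y. if j = 0 then y else (x + (j - 1) * y) mod m)"
    (is "transversal_design k m ?f")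
  unfolding transversal_design_def
proof (intro conjI allI impI)
  show "?f j x y < m" if "j < k" "x < m" "y < m" for j x y using that by simp
  fix i j assume i: "i < k" and j: "j < i"
  show "inj_on (\<lambda>(x, y). (?f i x y, ?f j x y)) ({..<m} \<times> {..<m})"
  proof (rule inj_onI, clarify)
    fix x y x' y' assume b: "x < m" "y < m" "x' < m" "y' < m"
      and ei: "?f i x y = ?f i x' y'" and ej: "?f j x y = ?f j x' y'"
    have small: "u = v" if "int m dvd int u - int v" "u < m" "v < m" for u v
    proof -
      have "int u mod int m = int v mod int m" using that(1) by (simp add: mod_eq_dvd_iff)
      then show ?thesis using that by simp
    qed
    have dvd: "int m dvd (int x - int x') + int (l - 1) * (int y - int y')"
      if "?f l x y = ?f l x' y'" "l > 0" for l
    proof -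
      have "(x + (l - 1) * y) mod m = (x' + (l - 1) * y') mod m" using that by simp
      then have "int m dvd int (x + (l - 1) * y) - int (x' + (l - 1) * y')"
        unfolding mod_eq_dvd_iff[symmetric] by (metis zmod_int)
      then show ?thesis by (simp only: of_nat_add of_nat_mult) (simp add: algebra_simps)
    qed
    have y: "y = y'"
    proof (cases "j = 0")
      case False
      have "int m dvd ((int x - int x') + int (i - 1) * (int y - int y'))
          - ((int x - int x') + int (j - 1) * (int y - int y'))"
        using dvd[OF ei] dvd[OF ej] False j by (intro dvd_diff) auto
      also have "\<dots> = int (i - j) * (int y - int y')"
        using False j by (simp add: algebra_simps of_nat_diff)
      finally have "int m dvd int (i - j) * (int y - int y')" .
      moreover have "coprime (i - j) m" by (rule cop) (use i j False in auto)
      then have "coprime (int m) (int (i - j))" by (simp only: coprime_int_iff coprime_commute)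
      ultimately have "int m dvd int y - int y'" by (simp add: coprime_dvd_mult_right_iff)
      then show ?thesis using small b by blast
    qed (use ej in simp)
    moreover have "int m dvd int x - int x'" using dvd[OF ei] j y by simp
    then have "x = x'" using small b by blast
    ultimately show "x = x' \<and> y = y'" by simp
  qed
qed

text \<open>MacNeish's product: block indices and points are split into base-\<open>n\<close>
  digits, and the two digits come from the two factors independently.\<close>

lemma transversal_design_product:
  assumes f: "transversal_design k m f" and g: "transversal_design k n g"
  shows "transversal_design k (m * n)
    (\<lambda>j x y. f j (x div n) (y div n) * n + g j (x mod n) (y mod n))"
    (is "transversal_design k _ ?h")
  unfolding transversal_design_def
proof (intro conjI allI impI)
  have dm: "x div n < m" "x mod n < n" if "x < m * n" for x
    using that by (auto simp: less_mult_imp_div_less intro!: mod_less_divisor intro: gr0I)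
  fix j x y assume j: "j < k" and x: "x < m * n" and y: "y < m * n"
  have "?h j x y < Suc (f j (x div n) (y div n)) * n"
    using transversal_design_less[OF g j dm(2)[OF x] dm(2)[OF y]] by simp
  also have "\<dots> \<le> m * n"
    using transversal_design_less[OF f j dm(1)[OF x] dm(1)[OF y]] by (intro mult_le_mono1) simp
  finally show "?h j x y < m * n" .
next
  have dm: "x div n < m" "x mod n < n" if "x < m * n" for x
    using that by (auto simp: less_mult_imp_div_less intro!: mod_less_divisor intro: gr0I)
  fix i j assume i: "i < k" and j: "j < i"
  have split: "a = a' \<and> b = b'" if "a * n + b = a' * n + b'" "b < n" "b' < n" for a b a' b'
  proof -
    have "(a * n + b) div n = a" "(a' * n + b') div n = a'" using that(2,3) by simp_all
    then show ?thesis using that by simp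
  qed
  show "inj_on (\<lambda>(x, y). (?h i x y, ?h j x y)) ({..<m * n} \<times> {..<m * n})"
  proof (rule inj_onI, clarify)
    fix x y x' y' assume b: "x < m * n" "y < m * n" "x' < m * n" "y' < m * n"
      and ei: "?h i x y = ?h i x' y'" and ej: "?h j x y = ?h j x' y'"
    have lt: "g l (u mod n) (v mod n) < n" if "l \<le> i" "u < m * n" "v < m * n" for l u v
      using transversal_design_less[OF g] dm that i by simp
    have F: "inj_on (\<lambda>(x, y). (f i x y, f j x y)) ({..<m} \<times> {..<m})"
      and G: "inj_on (\<lambda>(x, y). (g i x y, g j x y)) ({..<n} \<times> {..<n})"
      using f g i j unfolding transversal_design_def by blast+
    note si = split[OF ei lt lt] and sj = split[OF ej lt lt]
    have "(x div n, y div n) = (x' div n, y' div n)"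
      by (rule inj_onD[OF F]) (use si sj b j dm in auto)
    moreover have "(x mod n, y mod n) = (x' mod n, y' mod n)"
      by (rule inj_onD[OF G]) (use si sj b j dm in auto)
    ultimately show "x = x' \<and> y = y'" by (metis div_mult_mod_eq prod.inject)
  qed
qed

text \<open>Copy \<open>(x, y)\<close> lifts vertex \<open>p\<close> to height
  \<open>f (c p) x y\<close>. The ends of an edge have different colours and so use different groups
  of the transversal design; hence every pair of heights over the edge is attained by exactly one
  copy.\<close>

lemma decomposable_blow_coloured:
  assumes td: "transversal_design k m f"
    and A: "\<And>p q. (p, q) \<in> A \<Longrightarrow> (q, p) \<in> A"
    and c: "\<And>p q. (p, q) \<in> A \<Longrightarrow> c p < k \<and> c q < k \<and> c p \<noteq> c q"
  shows "decomposable {{p, q} | p q. (p, q) \<in> A} (blow m {{p, q} | p q. (p, q) \<in> A})"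
    (is "decomposable ?G _")
proof -
  let ?I = "{..<m} \<times> {..<m}"
  let ?b = "\<lambda>(x, y) p. (p, f (c p) x y)"
  let ?F = "{((p, a), (q, b)) | p q a b. (p, q) \<in> A \<and> a < m \<and> b < m}"
  have bij: "bij_betw (\<lambda>(x, y). (f (c p) x y, f (c q) x y)) ?I ?I" if "(p, q) \<in> A" for p q
    using transversal_design_bij[OF td] c[OF that] by blast
  have "decomposable ?G {{x, y} | x y. (x, y) \<in> ?F}"
  proof (rule decomposable_arcsI)
    show "inj_on (?b i) (fst ` A)" for i by (auto simp: inj_on_def split: prod.splits)
    show "bij_betw (\<lambda>(i, p, q). (?b i p, ?b i q)) (?I \<times> A) ?F"
      unfolding bij_betw_def
    proof
      show "inj_on (\<lambda>(i, p, q). (?b i p, ?b i q)) (?I \<times> A)"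
      proof (rule inj_onI)
        fix u v assume "u \<in> ?I \<times> A" "v \<in> ?I \<times> A"
          and eq: "(case u of (i, p, q) \<Rightarrow> (?b i p, ?b i q)) = (case v of (i, p, q) \<Rightarrow> (?b i p, ?b i q))"
        then obtain x y p q x' y' p' q'
          where u: "u = ((x, y), p, q)" "(x, y) \<in> ?I" "(p, q) \<in> A"
            and v: "v = ((x', y'), p', q')" "(x', y') \<in> ?I" "(p', q') \<in> A" by auto
        have pq: "p = p' \<and> q = q' \<and> f (c p) x y = f (c p') x' y' \<and> f (c q) x y = f (c q') x' y'"
          using eq unfolding u(1) v(1) by auto
        moreover have "(x, y) = (x', y')"
          by (rule inj_onD[OF bij_betw_imp_inj_on[OF bij[OF u(3)]] _ u(2) v(2)]) (use pq in auto)
        ultimately show "u = v" using u v by simp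
      qed
      show "(\<lambda>(i, p, q). (?b i p, ?b i q)) ` (?I \<times> A) = ?F"
      proof (intro equalityI subsetI)
        fix z assume "z \<in> (\<lambda>(i, p, q). (?b i p, ?b i q)) ` (?I \<times> A)"
        then obtain x y p q where *: "x < m" "y < m" "(p, q) \<in> A"
          "z = ((p, f (c p) x y), (q, f (c q) x y))" by auto
        then have "f (c p) x y < m" "f (c q) x y < m"
          using transversal_design_less[OF td] c by blast+
        then show "z \<in> ?F" using * by blast
      next
        fix z assume "z \<in> ?F"
        then obtain p q a b where *: "z = ((p, a), (q, b))" "(p, q) \<in> A" "a < m" "b < m" by blast
        then have "(a, b) \<in> (\<lambda>(x, y). (f (c p) x y, f (c q) x y)) ` ?I"
          using bij_betw_imp_surj_on[OF bij[OF *(2)]] by simp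
        then obtain x y where "(x, y) \<in> ?I" "a = f (c p) x y" "b = f (c q) x y" by auto
        then show "z \<in> (\<lambda>(i, p, q). (?b i p, ?b i q)) ` (?I \<times> A)"
          using * by (intro image_eqI[of _ _ "((x, y), (p, q))"]) auto
      qed
    qed
  qed (rule A)
  moreover have "blow m ?G = {{x, y} | x y. (x, y) \<in> ?F}"
  proof (intro equalityI subsetI)
    fix e assume "e \<in> blow m ?G"
    then obtain u v a b where e: "e = {(u, a), (v, b)}" "{u, v} \<in> ?G" "a < m" "b < m" by (rule blowE)
    from e(2) have "(u, v) \<in> A" using A by (auto simp: doubleton_eq_iff)
    then show "e \<in> {{x, y} | x y. (x, y) \<in> ?F}" using e by blast
  next
    fix e assume "e \<in> {{x, y} | x y. (x, y) \<in> ?F}"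
    then obtain p q a b where e: "e = {(p, a), (q, b)}" "(p, q) \<in> A" "a < m" "b < m" by blast
    moreover have "p \<noteq> q" using c[OF e(2)] by blast
    ultimately show "e \<in> blow m ?G" by (auto intro!: blowI)
  qed
  ultimately show ?thesis by simp
qed

text \<open>Deleting points from one group of a transversal design with five groups leaves blocks of
  sizes four and five.\<close>

lemma decomposable_truncated:
  assumes td: "transversal_design 5 m f" and sm: "s \<le> m"
    and four: "decomposable G (blow W (clique {..<4::nat}))"
    and five: "decomposable G (blow W (clique {..<5::nat}))"
    and dm: "decomposable G (clique {..<W * m + 1})"
    and ds: "decomposable G (clique {..<W * s + 1})"
  shows "decomposable G (clique {..<W * (4 * m + s) + 1})"
proof -
  let ?n = "\<lambda>j. if j = (4::nat) then s else m"
  define V where "V = (SIGMA j:{..<5}. {..<?n j})"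
  let ?C = "{{p, q} | p q. p \<in> V \<and> q \<in> V \<and> fst p \<noteq> fst q}"
  let ?I = "{..<m} \<times> {..<m}"
  define B where "B = (\<lambda>(x, y). (\<lambda>j. (j, f j x y)) ` {j. j < 5 \<and> f j x y < ?n j})"
  have fin: "finite V" unfolding V_def by auto
  have "card V = (\<Sum>j<5. ?n j)" unfolding V_def by simp
  also have "\<dots> = 4 * m + s" by (simp add: eval_nat_numeral)
  finally have cardV: "card V = 4 * m + s" .
  have group: "card {p \<in> V. fst p = j} = ?n j" if "j < 5" for j
  proof -
    have "{p \<in> V. fst p = j} = Pair j ` {..<?n j}" using that unfolding V_def by auto
    then show ?thesis by (simp add: card_image inj_on_def)
  qed
  have inB: "p \<in> B (x, y) \<longleftrightarrow> p \<in> V \<and> snd p = f (fst p) x y" for p x y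
    unfolding B_def V_def by (cases p) auto
  have dec: "decomposable G (blow W (clique (B i)))" if I: "i \<in> ?I" for i
  proof -
    obtain x y where i: "i = (x, y)" "x < m" "y < m" using I by auto
    define S where "S = {j. j < 5 \<and> f j x y < ?n j}"
    \<comment> \<open>Groups 0 to 3 are untouched, so a block can lose only its point in group
      4.\<close>
    have "{..<4} \<subseteq> S" unfolding S_def using transversal_design_less[OF td] i by auto
    moreover have "S \<subseteq> insert 4 {..<4}" unfolding S_def by auto
    ultimately have "S = {..<4} \<or> S = insert 4 {..<4}" by blast
    then have "card S = 4 \<or> card S = 5" by auto
    moreover have "card (B i) = card S" unfolding B_def S_def i by (simp add: card_image inj_on_def)
    ultimately have "card (B i) = card {..<4::nat} \<or> card (B i) = card {..<5::nat}" by simp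
    moreover have "finite (B i)" unfolding B_def i by simp
    ultimately have "iso_edges (clique {..<4::nat}) (clique (B i))
        \<or> iso_edges (clique {..<5::nat}) (clique (B i))"
      by (auto intro: clique_iso)
    then show ?thesis using four five blow_iso decomposable_iso by blast
  qed
  have disj: "clique (B i) \<inter> clique (B j) = {}" if "i \<in> ?I" "j \<in> ?I" "i \<noteq> j" for i j
  proof (rule ccontr)
    assume "clique (B i) \<inter> clique (B j) \<noteq> {}"
    then obtain e where e: "e \<in> clique (B i)" "e \<in> clique (B j)" by blast
    obtain x y x' y' where ij: "i = (x, y)" "j = (x', y')" by (metis surj_pair)
    from e(1) obtain p q where pq: "e = {p, q}" "p \<in> B i" "q \<in> B i" "p \<noteq> q" by (rule cliqueE)
    have "p \<in> B j" "q \<in> B j" using clique_subset[OF e(2)] pq by auto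
    then have eq: "f (fst p) x y = f (fst p) x' y'" "f (fst q) x y = f (fst q) x' y'"
      using pq(2,3) unfolding ij inB by simp_all
    \<comment> \<open>A block has at most one point in each group, so the two points lie in
      different groups and determine the block.\<close>
    have ne: "fst p \<noteq> fst q" using pq(2-4) unfolding ij inB by (metis prod_eqI)
    have "fst p < 5" "fst q < 5" using pq(2,3) unfolding ij inB V_def by auto
    then have bij: "bij_betw (\<lambda>(x, y). (f (fst p) x y, f (fst q) x y)) ?I ?I"
      using transversal_design_bij[OF td] ne by blast
    have "(x, y) = (x', y')"
      by (rule inj_onD[OF bij_betw_imp_inj_on[OF bij]]) (use that eq ij in simp_all)
    then show False using that ij by simp
  qed
  have C: "?C = \<Union> ((\<lambda>i. clique (B i)) ` ?I)"
  proof (intro equalityI subsetI)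
    fix e assume "e \<in> ?C"
    then obtain p q where pq: "e = {p, q}" "p \<in> V" "q \<in> V" "fst p \<noteq> fst q" by blast
    have "fst p < 5" "fst q < 5" using pq unfolding V_def by auto
    then have bij: "bij_betw (\<lambda>(x, y). (f (fst p) x y, f (fst q) x y)) ?I ?I"
      using transversal_design_bij[OF td] pq by blast
    have "snd p < m" "snd q < m" using pq(2,3) sm unfolding V_def by (auto split: if_splits)
    then have "(snd p, snd q) \<in> (\<lambda>(x, y). (f (fst p) x y, f (fst q) x y)) ` ?I"
      using bij_betw_imp_surj_on[OF bij] by simp
    then obtain x y where xy: "(x, y) \<in> ?I" "snd p = f (fst p) x y" "snd q = f (fst q) x y" by auto
    then have "e \<in> clique (B (x, y))" unfolding pq(1) by (intro cliqueI) (use pq inB in auto)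
    then show "e \<in> \<Union> ((\<lambda>i. clique (B i)) ` ?I)" using xy(1) by blast
  next
    fix e assume "e \<in> \<Union> ((\<lambda>i. clique (B i)) ` ?I)"
    then obtain x y where "e \<in> clique (B (x, y))" by auto
    then obtain p q where pq: "e = {p, q}" "p \<in> B (x, y)" "q \<in> B (x, y)" "p \<noteq> q" by (rule cliqueE)
    moreover have "fst p \<noteq> fst q" using pq(2-4) unfolding inB by (metis prod_eqI)
    ultimately show "e \<in> ?C" unfolding inB by blast
  qed
  have "decomposable G (blow W ?C)"
  proof -
    have "blow W (\<Union> ((\<lambda>i. clique (B i)) ` ?I)) = \<Union> ((\<lambda>i. blow W (clique (B i))) ` ?I)"
      unfolding blow_def by blast
    moreover have "decomposable G (\<Union> ((\<lambda>i. blow W (clique (B i))) ` ?I))"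
    proof (rule decomposable_Union)
      fix E assume "E \<in> (\<lambda>i. blow W (clique (B i))) ` ?I"
      then show "decomposable G E" using dec by (elim imageE) simp
    next
      fix E E' assume *: "E \<in> (\<lambda>i. blow W (clique (B i))) ` ?I" "E' \<in> (\<lambda>i. blow W (clique (B i))) ` ?I"
        "E \<noteq> E'"
      from *(1) obtain i where i: "i \<in> ?I" "E = blow W (clique (B i))" by (elim imageE) simp
      from *(2) obtain j where j: "j \<in> ?I" "E' = blow W (clique (B j))" by (elim imageE) simp
      have "clique (B i) \<inter> clique (B j) = {}" using disj i j *(3) by blast
      then show "E \<inter> E' = {}" using fst_image_blow i(2) j(2) by (metis disjoint_iff)
    qed
    ultimately show ?thesis unfolding C by simp
  qed
  then have "decomposable G (clique {..<W * card V + 1})"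
  proof (rule decomposable_fill[OF fin])
    fix j assume "j \<in> fst ` V"
    then have "j < 5" unfolding V_def by auto
    then show "decomposable G (clique {..<W * card {p \<in> V. fst p = j} + 1})"
      using group[of j] dm ds by simp
  qed
  then show ?thesis unfolding cardV .
qed

section \<open>Difference families\<close>

text \<open>The map \<open>r\<close> picks a representative of each coset of a subgroup, as reduction modulo \<open>n\<close>
  does for the integers, so that \<open>range r\<close> plays the role of the quotient group.\<close>

lemma difference_family:
  fixes r :: "'a::ab_group_add \<Rightarrow> 'a" and b :: "'i \<Rightarrow> 'v \<Rightarrow> 'a"
  assumes r_add: "\<And>x y. r (x + r y) = r (x + y)" and r_diff: "\<And>x y. r (x - r y) = r (x - y)"
    and sym: "\<And>p q. (p, q) \<in> A \<Longrightarrow> (q, p) \<in> A"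
    and inj: "\<And>i. i \<in> I \<Longrightarrow> inj_on (\<lambda>p. r (b i p)) (fst ` A)"
    and bij: "bij_betw (\<lambda>(i, p, q). r (b i p - b i q)) (I \<times> A) D"
  shows "decomposable {{p, q} | p q. (p, q) \<in> A}
    {{x, y} | x y. x \<in> range r \<and> y \<in> range r \<and> r (x - y) \<in> D}"
proof -
  have r_idem: "r (r x) = r x" for x using r_add[of 0 x] by simp
  have r_add': "r (r x + y) = r (x + y)" for x y using r_add[of y x] by (simp add: add.commute)
  have r_diff': "r (r x - y) = r (x - y)" for x y using r_add'[of x "- y"] by simp
  have cancel: "r x = r y" if "r (x + z) = r (y + z)" for x y z
    using r_diff'[of "x + z" z] r_diff'[of "y + z" z] that by simp
  have diff: "r (r (x + g) - r (y + g)) = r (x - y)" for x y g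
    by (simp add: r_diff r_diff')
  let ?c = "\<lambda>(i, g) p. r (b i p + g)"
  let ?J = "I \<times> range r"
  let ?F = "{(x, y). x \<in> range r \<and> y \<in> range r \<and> r (x - y) \<in> D}"
  have "decomposable {{p, q} | p q. (p, q) \<in> A} {{x, y} | x y. (x, y) \<in> ?F}"
  proof (rule decomposable_arcsI)
    fix j assume "j \<in> ?J"
    then obtain i g where j: "j = (i, g)" "i \<in> I" by auto
    show "inj_on (?c j) (fst ` A)"
    proof (rule inj_onI)
      fix p q assume "p \<in> fst ` A" "q \<in> fst ` A" "?c j p = ?c j q"
      moreover then have "r (b i p) = r (b i q)" by (simp add: j(1)) (rule cancel)
      ultimately show "p = q" using inj_onD[OF inj[OF j(2)]] by blast
    qed
  next
    show "bij_betw (\<lambda>(j, p, q). (?c j p, ?c j q)) (?J \<times> A) ?F"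
      unfolding bij_betw_def
    proof
      show "inj_on (\<lambda>(j, p, q). (?c j p, ?c j q)) (?J \<times> A)"
      proof (rule inj_onI)
        fix u v assume "u \<in> ?J \<times> A" "v \<in> ?J \<times> A"
          and eq: "(case u of (j, p, q) \<Rightarrow> (?c j p, ?c j q)) = (case v of (j, p, q) \<Rightarrow> (?c j p, ?c j q))"
        then obtain i g p q i' g' p' q' where u: "u = ((i, g), p, q)" "i \<in> I" "g \<in> range r" "(p, q) \<in> A"
          and v: "v = ((i', g'), p', q')" "i' \<in> I" "g' \<in> range r" "(p', q') \<in> A" by auto
        have e: "r (b i p + g) = r (b i' p' + g')" "r (b i q + g) = r (b i' q' + g')"
          using eq unfolding u v by auto
        \<comment> \<open>Translation preserves the difference, which by \<open>bij\<close>
          identifies base block and arc; comparing one endpoint then identifies the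
          translation.\<close>
        then have "r (b i p - b i q) = r (b i' p' - b i' q')"
          using diff[of "b i p" g "b i q"] diff[of "b i' p'" g' "b i' q'"] by simp
        then have same: "(i, p, q) = (i', p', q')"
          using u v by (intro inj_onD[OF bij_betw_imp_inj_on[OF bij]]) auto
        then have "r (g + b i p) = r (g' + b i p)" using e(1) by (simp add: add.commute)
        then have "r g = r g'" by (rule cancel)
        then have "g = g'" using u v r_idem by auto
        then show "u = v" using u v same by simp
      qed
      show "(\<lambda>(j, p, q). (?c j p, ?c j q)) ` (?J \<times> A) = ?F"
      proof (intro equalityI subsetI)
        fix z assume "z \<in> (\<lambda>(j, p, q). (?c j p, ?c j q)) ` (?J \<times> A)"
        then obtain i g p q where z: "i \<in> I" "(p, q) \<in> A" "z = (r (b i p + g), r (b i q + g))" by auto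
        moreover have "r (b i p - b i q) \<in> D"
          using bij_betw_imp_surj_on[OF bij] z(1,2) by force
        ultimately show "z \<in> ?F" by (simp add: diff)
      next
        fix z assume "z \<in> ?F"
        then obtain x y where z: "z = (x, y)" "x \<in> range r" "y \<in> range r" "r (x - y) \<in> D" by blast
        then obtain i p q where ipq: "i \<in> I" "(p, q) \<in> A" "r (x - y) = r (b i p - b i q)"
          using bij_betw_imp_surj_on[OF bij] by force
        \<comment> \<open>The translation that carries vertex \<open>p\<close> of the base block to
          \<open>x\<close>; equality of differences then puts \<open>q\<close> on
          \<open>y\<close>.\<close>
        let ?g = "r (x - b i p)"
        have "r (b i p + ?g) = x" using z(2) by (auto simp: r_add r_idem)
        moreover have "r (b i q + ?g) = y"
        proof -
          have "r (b i q + ?g) = r (x - (b i p - b i q))" by (simp add: r_add algebra_simps)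
          also have "\<dots> = r (x - (x - y))" by (metis r_diff ipq(3))
          also have "\<dots> = y" using z(3) by (auto simp: r_idem)
          finally show ?thesis .
        qed
        ultimately show "z \<in> (\<lambda>(j, p, q). (?c j p, ?c j q)) ` (?J \<times> A)"
          using z(1) ipq by (intro image_eqI[of _ _ "((i, ?g), (p, q))"]) auto
      qed
    qed
  qed (rule sym)
  then show ?thesis by simp
qed

section \<open>Verified base blocks\<close>

fun merge :: "'a::linorder list \<Rightarrow> 'a list \<Rightarrow> 'a list" where
  "merge [] ys = ys"
| "merge xs [] = xs"
| "merge (x # xs) (y # ys) = (if x \<le> y then x # merge xs (y # ys) else y # merge (x # xs) ys)"

fun merge_pairs :: "'a::linorder list list \<Rightarrow> 'a list list" where
  "merge_pairs (xs # ys # zss) = merge xs ys # merge_pairs zss"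
| "merge_pairs xss = xss"

text \<open>Ten rounds sort every list of length at most 1024; longer lists are merely permuted.\<close>

definition merge_sort :: "'a::linorder list \<Rightarrow> 'a list" where
  "merge_sort xs = concat ((merge_pairs ^^ 10) (map (\<lambda>x. [x]) xs))"

lemma mset_merge: "mset (merge xs ys) = mset xs + mset ys"
  by (induction xs ys rule: merge.induct) auto

lemma mset_merge_pairs: "mset (concat (merge_pairs xss)) = mset (concat xss)"
  by (induction xss rule: merge_pairs.induct) (auto simp: mset_merge)

text \<open>Evaluating the output to an explicit list without repetitions yields, for the input,
  both its set of entries and the absence of repetitions.\<close>

lemma mset_merge_sort: "mset (merge_sort xs) = mset xs"
proof -
  have "mset (concat ((merge_pairs ^^ n) xss)) = mset (concat xss)" for n and xss :: "'a list list"
    by (induction n) (auto simp: mset_merge_pairs)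
  then have "mset (merge_sort xs) = mset (concat (map (\<lambda>x. [x]) xs))" unfolding merge_sort_def .
  then show ?thesis by simp
qed

lemma set_merge_sort: "set (merge_sort xs) = set xs"
  using mset_merge_sort by (rule mset_eq_setD)

lemma distinct_merge_sort: "distinct (merge_sort xs) = distinct xs"
  using mset_merge_sort by (rule mset_eq_imp_distinct_iff)

section \<open>Difference families given by lists\<close>

definition differences :: "('a::ab_group_add \<Rightarrow> 'a) \<Rightarrow> (nat \<times> nat) list \<Rightarrow> 'a list list \<Rightarrow> 'a list" where
  "differences r arcs bs = map (\<lambda>(b, p, q). r (b ! p - b ! q)) (List.product bs arcs)"

text \<open>Vertex \<open>4 * i + j\<close> is the cell in row \<open>i\<close> and column
  \<open>j\<close> of the board. Both orientations of each edge are listed, as the arc form of the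
  decomposition criterion expects.\<close>

definition rook_arcs :: "(nat \<times> nat) list" where
  "rook_arcs = filter (\<lambda>(p, q). p \<noteq> q \<and> (p div 4 = q div 4 \<or> p mod 4 = q mod 4))
     (List.product [0..<16] [0..<16])"

definition rook :: "nat set set" where
  "rook = {{p, q} | p q. (p, q) \<in> set rook_arcs}"

definition K4_arcs :: "(nat \<times> nat) list" where
  "K4_arcs = filter (\<lambda>(p, q). p \<noteq> q) (List.product [0..<4] [0..<4])"

text \<open>Distinctness of the list of differences is an executable form of the injectivity in
  \<open>difference_family\<close>; surjectivity is built into the target set.\<close>

lemma difference_family_list:
  fixes r :: "'a::ab_group_add \<Rightarrow> 'a"
  assumes r_add: "\<And>x y. r (x + r y) = r (x + y)" and r_diff: "\<And>x y. r (x - r y) = r (x - y)"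
    and sym: "\<And>p q. (p, q) \<in> set arcs \<Longrightarrow> p < k \<and> (q, p) \<in> set arcs"
    and inj: "\<And>b. b \<in> set bs \<Longrightarrow> length b = k \<and> distinct (map r b)"
    and dist: "distinct (differences r arcs bs)"
  shows "decomposable {{p, q} | p q. (p, q) \<in> set arcs}
    {{x, y} | x y. x \<in> range r \<and> y \<in> range r \<and> r (x - y) \<in> set (differences r arcs bs)}"
proof (rule difference_family[OF r_add r_diff])
  show "(q, p) \<in> set arcs" if "(p, q) \<in> set arcs" for p q using sym that by blast
  show "inj_on (\<lambda>p. r (b ! p)) (fst ` set arcs)" if "b \<in> set bs" for b
  proof (rule inj_onI)
    fix p q assume "p \<in> fst ` set arcs" "q \<in> fst ` set arcs" "r (b ! p) = r (b ! q)"
    moreover then have "p < length b" "q < length b" using sym inj[OF that] by auto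
    ultimately show "p = q" using inj[OF that] nth_eq_iff_index_eq[of "map r b" p q] by simp
  qed
  show "bij_betw (\<lambda>(b, p, q). r (b ! p - b ! q)) (set bs \<times> set arcs) (set (differences r arcs bs))"
    using dist unfolding differences_def bij_betw_def by (simp add: distinct_map)
qed

text \<open>Two representatives are distinct exactly when their difference is nonzero, so covering
  each nonzero difference once covers each edge once.\<close>

lemma difference_family_clique:
  fixes r :: "'a::ab_group_add \<Rightarrow> 'a"
  assumes r_add: "\<And>x y. r (x + r y) = r (x + y)" and r_diff: "\<And>x y. r (x - r y) = r (x - y)"
    and sym: "\<And>p q. (p, q) \<in> set arcs \<Longrightarrow> p < k \<and> (q, p) \<in> set arcs"
    and inj: "\<And>b. b \<in> set bs \<Longrightarrow> length b = k \<and> distinct (map r b)"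
    and dist: "distinct (differences r arcs bs)"
    and all: "set (differences r arcs bs) = range r - {r 0}"
  shows "decomposable {{p, q} | p q. (p, q) \<in> set arcs} (clique (range r))"
proof -
  have idem: "r x = x" if "x \<in> range r" for x using that r_add[of 0] by auto
  have zero: "x = y" if xy: "x \<in> range r" "y \<in> range r" "r (x - y) = r 0" for x y
  proof -
    have "x = r (y + r (x - y))" using idem[OF xy(1)] by (simp add: r_add)
    also have "\<dots> = y" using idem[OF xy(2)] xy(3) r_add[of y 0] by simp
    finally show ?thesis .
  qed
  have "{{x, y} | x y. x \<in> range r \<and> y \<in> range r \<and> r (x - y) \<in> set (differences r arcs bs)}
      = clique (range r)"
  proof (intro equalityI subsetI)
    fix e assume "e \<in> {{x, y} | x y. x \<in> range r \<and> y \<in> range r \<and> r (x - y) \<in> set (differences r arcs bs)}"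
    then obtain x y where e: "e = {x, y}" "x \<in> range r" "y \<in> range r" "r (x - y) \<noteq> r 0"
      unfolding all by blast
    then have "x \<noteq> y" by auto
    then show "e \<in> clique (range r)" unfolding e(1) by (intro cliqueI e)
  next
    fix e assume "e \<in> clique (range r)"
    then obtain x y where e: "e = {x, y}" "x \<in> range r" "y \<in> range r" "x \<noteq> y" by (rule cliqueE)
    then have "r (x - y) \<in> range r - {r 0}" using zero by blast
    then show "e \<in> {{x, y} | x y. x \<in> range r \<and> y \<in> range r \<and> r (x - y) \<in> set (differences r arcs bs)}"
      unfolding all using e by blast
  qed
  then show ?thesis using difference_family_list[OF r_add r_diff sym inj dist] by simp
qed

lemma rook_arcs_sym: "(p, q) \<in> set rook_arcs \<Longrightarrow> p < 16 \<and> (q, p) \<in> set rook_arcs"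
  unfolding rook_arcs_def by auto

lemma K4_arcs_sym: "(p, q) \<in> set K4_arcs \<Longrightarrow> p < 4 \<and> (q, p) \<in> set K4_arcs"
  unfolding K4_arcs_def by auto

lemma K4_arcs_clique: "{{p, q} | p q. (p, q) \<in> set K4_arcs} = clique {..<4}"
  unfolding K4_arcs_def clique_def by auto

text \<open>The sorted list \<open>[1..n - 1]\<close> certifies that each nonzero residue modulo
  \<open>n\<close> arises from exactly one arc of one base block.\<close>

lemma rook_cyclic:
  fixes n :: int
  assumes n: "n > 0"
    and inj: "list_all (\<lambda>b. length b = 16 \<and> distinct (map (\<lambda>x. x mod n) b)) bs"
    and diff: "merge_sort (differences (\<lambda>x. x mod n) rook_arcs bs) = [1..n - 1]"
  shows "decomposable rook (clique {..<nat n})"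
proof -
  have ran: "range (\<lambda>x::int. x mod n) = {0..<n}"
  proof (intro equalityI subsetI)
    fix x assume "x \<in> {0..<n}"
    then show "x \<in> range (\<lambda>x::int. x mod n)" by (intro image_eqI[of _ _ x]) auto
  qed (use n in auto)
  have "decomposable rook (clique (range (\<lambda>x::int. x mod n)))"
    unfolding rook_def
  proof (rule difference_family_clique)
    show "(x + y mod n) mod n = (x + y) mod n" "(x - y mod n) mod n = (x - y) mod n" for x y
      by (simp_all add: mod_simps)
    show "length b = 16 \<and> distinct (map (\<lambda>x. x mod n) b)" if "b \<in> set bs" for b
      using inj that by (simp add: list_all_iff)
    show "distinct (differences (\<lambda>x. x mod n) rook_arcs bs)"
      by (metis diff distinct_merge_sort distinct_upto)
    have "set (differences (\<lambda>x. x mod n) rook_arcs bs) = set [1..n - 1]"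
      by (metis diff set_merge_sort)
    then show "set (differences (\<lambda>x. x mod n) rook_arcs bs) = range (\<lambda>x. x mod n) - {0 mod n}"
      unfolding ran by auto
  qed (rule rook_arcs_sym)
  moreover have "iso_edges (clique (range (\<lambda>x::int. x mod n))) (clique {..<nat n})"
    unfolding ran by (rule clique_iso) auto
  ultimately show ?thesis by (rule decomposable_iso)
qed

text \<open>The points are the residues modulo \<open>g * u\<close>, and the groups are the residue
  classes modulo \<open>u\<close>, each of size \<open>g\<close>. Points lie in different groups
  exactly when their difference is not a multiple of \<open>u\<close>.\<close>

lemma K4_group_divisible:
  fixes g u :: nat
  assumes gu: "g > 0" "u > 0" and n: "n = int (g * u)"
    and inj: "list_all (\<lambda>b. length b = 4 \<and> distinct (map (\<lambda>x. x mod n) b)) bs"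
    and diff: "merge_sort (differences (\<lambda>x. x mod n) K4_arcs bs) = filter (\<lambda>d. d mod int u \<noteq> 0) [0..n - 1]"
  shows "decomposable (clique {..<4::nat}) (blow g (clique {..<u}))"
proof -
  let ?D = "differences (\<lambda>x. x mod n) K4_arcs bs"
  have n0: "n > 0" using n gu by simp
  have ran: "range (\<lambda>x::int. x mod n) = {0..<n}"
  proof (intro equalityI subsetI)
    fix x assume "x \<in> {0..<n}"
    then show "x \<in> range (\<lambda>x::int. x mod n)" by (intro image_eqI[of _ _ x]) auto
  qed (use n0 in auto)
  have "set ?D = set (filter (\<lambda>d. d mod int u \<noteq> 0) [0..n - 1])" by (metis diff set_merge_sort)
  then have setD: "set ?D = {d. 0 \<le> d \<and> d < n \<and> d mod int u \<noteq> 0}" by auto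
  have D: "(x - y) mod n \<in> set ?D \<longleftrightarrow> x mod int u \<noteq> y mod int u" for x y
  proof -
    have "(x - y) mod n mod int u = (x - y) mod int u" unfolding n by (simp add: mod_mod_cancel)
    moreover have "x mod int u = y mod int u \<longleftrightarrow> (x - y) mod int u = 0"
      by (simp only: mod_eq_dvd_iff dvd_eq_mod_eq_0)
    ultimately show ?thesis using n0 unfolding setD by simp
  qed
  let ?E = "{{x, y} | x y. x \<in> {0..<n} \<and> y \<in> {0..<n} \<and> x mod int u \<noteq> y mod int u}"
  have "decomposable {{p, q} | p q. (p, q) \<in> set K4_arcs}
      {{x, y} | x y. x \<in> range (\<lambda>x. x mod n) \<and> y \<in> range (\<lambda>x. x mod n) \<and> (x - y) mod n \<in> set ?D}"
  proof (rule difference_family_list)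
    show "(x + y mod n) mod n = (x + y) mod n" "(x - y mod n) mod n = (x - y) mod n" for x y
      by (simp_all add: mod_simps)
    show "length b = 4 \<and> distinct (map (\<lambda>x. x mod n) b)" if "b \<in> set bs" for b
      using inj that by (simp add: list_all_iff)
    have "distinct (filter (\<lambda>d. d mod int u \<noteq> 0) [0..n - 1])" by (intro distinct_filter distinct_upto)
    then show "distinct ?D" by (metis diff distinct_merge_sort)
  qed (rule K4_arcs_sym)
  then have "decomposable (clique {..<4::nat}) ?E" unfolding K4_arcs_clique ran D .
  moreover have "iso_edges ?E (blow g (clique {..<u}))"
  proof -
    let ?f = "\<lambda>x. (nat (x mod int u), nat (x div int u))"
    have "inj_on ?f (\<Union>?E)"
    proof (rule inj_onI)
      fix x y assume "x \<in> \<Union>?E" "y \<in> \<Union>?E" and eq: "?f x = ?f y"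
      then have "0 \<le> x" "0 \<le> y" by auto
      then have "x mod int u = y mod int u" "x div int u = y div int u"
        using eq gu by (simp_all add: eq_nat_nat_iff pos_imp_zdiv_nonneg_iff)
      then show "x = y" by (metis div_mult_mod_eq)
    qed
    moreover have "blow g (clique {..<u}) = (\<lambda>e. ?f ` e) ` ?E"
    proof (intro equalityI subsetI)
      fix e assume "e \<in> blow g (clique {..<u})"
      then obtain v w a b where e: "e = {(v, a), (w, b)}" "{v, w} \<in> clique {..<u}" "v \<noteq> w" "a < g" "b < g"
        by (rule blowE)
      have vw: "v < u" "w < u" using clique_subset[OF e(2)] by auto
      have rng: "a * u + v < g * u" if "a < g" "v < u" for a v
      proof -
        have "a * u + v < Suc a * u" using that by simp
        also have "\<dots> \<le> g * u" using that by (intro mult_le_mono1) simp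
        finally show ?thesis .
      qed
      have f: "?f (int (a * u + v)) = (v, a)" if "v < u" for a v
        using that by (simp add: zmod_int[symmetric] zdiv_int[symmetric] del: of_nat_add of_nat_mult)
      have md: "int (a * u + v) mod int u = int v" if "v < u" for a v
        using that by (simp add: zmod_int[symmetric] del: of_nat_add of_nat_mult)
      have "{int (a * u + v), int (b * u + w)} \<in> ?E"
        using rng[OF e(4) vw(1)] rng[OF e(5) vw(2)] md[OF vw(1), of a] md[OF vw(2), of b] e(3)
        unfolding n by (intro CollectI exI conjI) (rule refl, auto simp del: of_nat_add of_nat_mult)
      moreover have "e = ?f ` {int (a * u + v), int (b * u + w)}"
        unfolding e(1) image_insert image_empty f[OF vw(1)] f[OF vw(2)] ..
      ultimately show "e \<in> (\<lambda>e. ?f ` e) ` ?E" by blast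
    next
      fix e assume "e \<in> (\<lambda>e. ?f ` e) ` ?E"
      then obtain d where "d \<in> ?E" "e = ?f ` d" by (elim imageE)
      then obtain x y where e: "e = {?f x, ?f y}" "x \<in> {0..<n}" "y \<in> {0..<n}" "x mod int u \<noteq> y mod int u"
        by auto
      have b: "nat (z mod int u) < u" "nat (z div int u) < g" if "z \<in> {0..<n}" for z
      proof -
        show "nat (z mod int u) < u" using gu by (simp add: nat_less_iff)
        have "z div int u * int u \<le> z"
          using gu minus_mod_eq_div_mult[of z "int u"] by (smt (verit) of_nat_0_less_iff pos_mod_sign)
        also have "\<dots> < int g * int u" using that unfolding n by simp
        finally have "z div int u < int g" using gu by simp
        moreover have "0 \<le> z div int u" using that gu by (simp add: pos_imp_zdiv_nonneg_iff)
        ultimately show "nat (z div int u) < g" by (simp add: nat_less_iff)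
      qed
      have "nat (x mod int u) \<noteq> nat (y mod int u)" using e(4) gu by (simp add: eq_nat_nat_iff)
      then show "e \<in> blow g (clique {..<u})"
        unfolding e(1) by (intro blowI cliqueI) (use b e(2,3) in auto)
    qed
    ultimately show ?thesis unfolding iso_edges_def by blast
  qed
  ultimately show ?thesis by (rule decomposable_iso)
qed

section \<open>Group divisible designs with block size four\<close>

lemma K4_group_divisible_3_5: "decomposable (clique {..<4::nat}) (blow 3 (clique {..<5::nat}))"
  by (rule K4_group_divisible[where n = 15 and bs = "[[0, 1, 3, 7]]"], simp, simp, simp) code_simp+

lemma K4_group_divisible_2_7: "decomposable (clique {..<4::nat}) (blow 2 (clique {..<7::nat}))"
  by (rule K4_group_divisible[where n = 14 and bs = "[[0, 1, 4, 6]]"], simp, simp, simp) code_simp+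

lemma K4_group_divisible_6_9: "decomposable (clique {..<4::nat}) (blow 6 (clique {..<9::nat}))"
  by (rule K4_group_divisible[where n = 54 and bs =
      "[[0, 1, 3, 13], [0, 4, 19, 26], [0, 5, 21, 29], [0, 6, 17, 40]]"], simp, simp, simp) code_simp+

text \<open>The blocks are the multiples of the first by the powers of 25, which is 1 modulo 6 and
  has order 5 modulo 11.\<close>

lemma K4_group_divisible_6_11: "decomposable (clique {..<4::nat}) (blow 6 (clique {..<11::nat}))"
  by (rule K4_group_divisible[where n = 66 and bs =
      "[[0, 12, 13, 58], [0, 36, 61, 64], [0, 48, 19, 34], [0, 60, 43, 4], [0, 42, 7, 16]]"],
      simp, simp, simp) code_simp+

text \<open>The block is a perfect difference set; its translates are the lines of the projective
  plane of order 3.\<close>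

lemma K4_group_divisible_1_13: "decomposable (clique {..<4::nat}) (blow 1 (clique {..<13::nat}))"
  by (rule K4_group_divisible[where n = 13 and bs = "[[0, 1, 3, 9]]"], simp, simp, simp) code_simp+

text \<open>The first block for each prime modulus is the union of \<open>{0}\<close> and five cosets of the group of
  cube roots of unity, which act on it as graph automorphisms; its 48 differences up to sign then
  form 16 orbits, chosen to lie in distinct cosets of the subgroup of index 16. The other blocks are
  its multiples by powers of a generator of that subgroup.\<close>

lemma rook_97: "decomposable rook (clique {..<97::nat})"
proof -
  have "decomposable rook (clique {..<nat 97})"
    by (rule rook_cyclic[where bs =
        "[[6, 54, 40, 70, 42, 16, 47, 25, 93, 15, 75, 2, 53, 12, 32, 0]]"], simp)
      code_simp+
  then show ?thesis by simp
qed

lemma rook_193: "decomposable rook (clique {..<193::nat})"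
proof -
  have "decomposable rook (clique {..<nat 193})"
    by (rule rook_cyclic[where bs =
        "[[38, 183, 177, 161, 7, 104, 125, 14, 78, 9, 51, 18, 115, 10, 68, 0], [125, 89,
         181, 169, 150, 78, 142, 107, 155, 55, 183, 110, 38, 104, 51, 0]]"], simp)
      code_simp+
  then show ?thesis by simp
qed

lemma rook_577: "decomposable rook (clique {..<577::nat})"
proof -
  have "decomposable rook (clique {..<nat 577})"
    by (rule rook_cyclic[where bs =
        "[[483, 367, 200, 28, 475, 498, 511, 355, 276, 479, 173, 194, 406, 243, 505, 0],
         [227, 102, 315, 448, 99, 467, 98, 487, 377, 163, 460, 219, 149, 426, 2, 0], [170,
         478, 424, 244, 430, 548, 414, 291, 262, 300, 436, 42, 76, 469, 32, 0], [412, 147,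
         437, 442, 533, 113, 277, 40, 153, 184, 52, 95, 62, 3, 512, 0], [245, 44, 68, 148,
         450, 77, 393, 63, 140, 59, 255, 366, 415, 48, 114, 0], [458, 127, 511, 60, 276,
         78, 518, 431, 509, 367, 41, 86, 293, 191, 93, 0]]"], simp)
      code_simp+
  then show ?thesis by simp
qed

text \<open>The same with the field of order 289, whose element \<open>x + y\<surd>3\<close> is written \<open>(x, y)\<close>.\<close>

lemma rook_289: "decomposable rook (clique {..<289::nat})"
proof -
  define r :: "int \<times> int \<Rightarrow> int \<times> int" where "r = (\<lambda>(x, y). (x mod 17, y mod 17))"
  define bs :: "(int \<times> int) list list" where "bs =
    [[(16, 16), (0, 13), (16, 15), (4, 12), (14, 16), (3, 7), (10, 2), (2, 2), (7, 2), (4,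
    3), (15, 11), (11, 3), (6, 12), (1, 6), (10, 16), (0, 0)], [(14, 7), (8, 14), (16, 2),
    (13, 12), (4, 14), (1, 16), (12, 9), (6, 3), (14, 11), (14, 1), (2, 11), (15, 2), (6,
    5), (10, 1), (1, 11), (0, 0)], [(5, 3), (12, 8), (8, 5), (7, 6), (9, 5), (7, 0), (8,
    3), (7, 11), (14, 6), (0, 7), (5, 14), (3, 0), (3, 4), (14, 4), (0, 9), (0, 0)]]"
  \<comment> \<open>Base-17 digits turn pairs into integers, so that the nonzero elements become 1
    to 288 and can be sorted.\<close>
  let ?code = "\<lambda>(x, y). 17 * x + y :: int"
  have diff: "merge_sort (map ?code (differences r rook_arcs bs)) = [1..288]"
    unfolding r_def bs_def by code_simp
  have inj: "list_all (\<lambda>b. length b = 16 \<and> distinct (map r b)) bs"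
    unfolding r_def bs_def by code_simp
  have ran: "range r = {0..<17} \<times> {0..<17}"
  proof (intro equalityI subsetI)
    fix x assume "x \<in> {0..<17::int} \<times> {0..<17::int}"
    then show "x \<in> range r" by (intro image_eqI[of _ _ x]) (auto simp: r_def)
  qed (auto simp: r_def)
  have code_inj: "inj_on ?code (range r)" 
    by (rule inj_on_inverseI[where g = "\<lambda>z. (z div 17, z mod 17)"]) (auto simp: ran)
  have r0: "r 0 = (0, 0)" by (simp add: r_def zero_prod_def)
  have code_ran: "?code ` (range r - {r 0}) = {1..288}"
  proof (intro equalityI subsetI)
    fix z :: int assume z: "z \<in> {1..288}"
    then have "(z div 17, z mod 17) \<in> range r - {r 0}" unfolding ran r0 by auto
    then show "z \<in> ?code ` (range r - {r 0})"
      by (intro image_eqI[of _ _ "(z div 17, z mod 17)"]) simp_all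
  next
    fix z assume "z \<in> ?code ` (range r - {r 0})"
    then obtain p where "p \<in> range r" "p \<noteq> (0, 0)" "z = ?code p" unfolding r0 by blast
    moreover obtain x y where "p = (x, y)" by (cases p)
    ultimately have "z = 17 * x + y" "x \<in> {0..<17}" "y \<in> {0..<17}" "x \<noteq> 0 \<or> y \<noteq> 0"
      unfolding ran by auto
    then show "z \<in> {1..288}" by auto
  qed
  have sub: "set (differences r rook_arcs bs) \<subseteq> range r"
    unfolding differences_def by auto
  have "set (map ?code (differences r rook_arcs bs)) = set [1..288]" by (metis diff set_merge_sort)
  then have "?code ` set (differences r rook_arcs bs) = ?code ` (range r - {r 0})"
    unfolding code_ran by (simp del: set_map add: set_map)
  then have all: "set (differences r rook_arcs bs) = range r - {r 0}"
    by (rule inj_on_image_eq_iff[OF code_inj sub Diff_subset, THEN iffD1])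
  have "decomposable rook (clique (range r))"
    unfolding rook_def
  proof (rule difference_family_clique)
    show "r (x + r y) = r (x + y)" "r (x - r y) = r (x - y)" for x y
      by (cases x; cases y; simp add: r_def mod_simps)+
    show "length b = 16 \<and> distinct (map r b)" if "b \<in> set bs" for b
      using inj that by (simp add: list_all_iff)
    have "distinct (map ?code (differences r rook_arcs bs))"
      by (metis diff distinct_merge_sort distinct_upto)
    then show "distinct (differences r rook_arcs bs)" by (simp add: distinct_map)
  qed (fact rook_arcs_sym all)+
  moreover have "iso_edges (clique (range r)) (clique {..<289::nat})"
    unfolding ran by (rule clique_iso) auto
  ultimately show ?thesis by (rule decomposable_iso)
qed

text \<open>Points of the affine plane of order 4: one parallel class gives the parts, and the other four
  are split into two pairs.\<close>

lemma rook_blow_4: "decomposable rook (blow 4 (clique {..<4::nat}))"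
proof -
  define bs :: "nat list list" where "bs =
    [[0, 4, 8, 12, 5, 1, 13, 9, 10, 14, 2, 6, 15, 11, 7, 3], [0, 14, 7, 9, 11, 5, 12, 2,
    13, 3, 10, 4, 6, 8, 1, 15]]"
  let ?L = "map (\<lambda>(b, p, q). (b ! p, b ! q)) (List.product bs rook_arcs)"
  let ?T = "filter (\<lambda>(x, y). x div 4 \<noteq> y div 4) (List.product [0..<16] [0..<16]) :: (nat \<times> nat) list"
  have dist: "distinct ?L" unfolding bs_def by code_simp
  have "list_all (\<lambda>(x, y). x < 16 \<and> y < 16 \<and> x div 4 \<noteq> y div 4) ?L"
    unfolding bs_def by code_simp
  then have ok: "case z of (x, y) \<Rightarrow> x < 16 \<and> y < 16 \<and> x div 4 \<noteq> y div 4" if "z \<in> set ?L" for z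
    using that unfolding list_all_iff by (rule bspec)
  have sub: "set ?L \<subseteq> set ?T"
  proof
    show "z \<in> set ?T" if "z \<in> set ?L" for z using ok[OF that] by (cases z) simp
  qed
  \<comment> \<open>Both lists have 192 entries, so a duplicate-free \<open>?L\<close> inside
    \<open>?T\<close> exhausts it.\<close>
  have len: "length ?L = length ?T" unfolding bs_def by code_simp
  have "distinct ?T" by (simp add: distinct_product)
  then have setL: "set ?L = set ?T"
    using card_subset_eq[OF _ sub] distinct_card[OF dist] distinct_card[of ?T] len by simp
  have inj: "list_all (\<lambda>b. length b = 16 \<and> distinct b) bs" unfolding bs_def by code_simp
  have "decomposable rook {{x, y} | x y. (x, y) \<in> set ?T}"
    unfolding rook_def
  proof (rule decomposable_arcsI)
    show "(q, p) \<in> set rook_arcs" if "(p, q) \<in> set rook_arcs" for p q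
      using rook_arcs_sym[OF that] by blast
    show "inj_on ((!) b) (fst ` set rook_arcs)" if "b \<in> set bs" for b
    proof -
      have "length b = 16" "distinct b" using inj that by (simp_all add: list_all_iff)
      then show ?thesis using rook_arcs_sym by (intro inj_on_nth) auto
    qed
    show "bij_betw (\<lambda>(b, p, q). (b ! p, b ! q)) (set bs \<times> set rook_arcs) (set ?T)"
      using dist unfolding setL[symmetric] bij_betw_def by (simp add: distinct_map)
  qed
  moreover have "iso_edges {{x, y} | x y. (x, y) \<in> set ?T} (blow 4 (clique {..<4::nat}))"
    (is "iso_edges ?E _")
  proof -
    let ?f = "\<lambda>x::nat. (x div 4, x mod 4)"
    have "inj_on ?f (\<Union>?E)" by (rule inj_onI) (metis div_mult_mod_eq prod.inject)
    moreover have "blow 4 (clique {..<4::nat}) = (\<lambda>e. ?f ` e) ` ?E"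
    proof (intro equalityI subsetI)
      fix e assume "e \<in> blow 4 (clique {..<4::nat})"
      then obtain v w a b where e: "e = {(v, a), (w, b)}" "{v, w} \<in> clique {..<4}" "v \<noteq> w" "a < 4" "b < 4"
        by (rule blowE)
      have vw: "v < 4" "w < 4" using clique_subset[OF e(2)] by auto
      have "(4 * v + a, 4 * w + b) \<in> set ?T" using e vw by auto
      moreover have "e = ?f ` {4 * v + a, 4 * w + b}" using e by simp
      ultimately show "e \<in> (\<lambda>e. ?f ` e) ` ?E" by blast
    next
      fix e assume "e \<in> (\<lambda>e. ?f ` e) ` ?E"
      then obtain d where "d \<in> ?E" "e = ?f ` d" by (elim imageE)
      then obtain x y where e: "e = {?f x, ?f y}" "x < 16" "y < 16" "x div 4 \<noteq> y div 4" by auto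
      then show "e \<in> blow 4 (clique {..<4::nat})"
        unfolding e(1) by (intro blowI cliqueI) auto
    qed
    ultimately show ?thesis unfolding iso_edges_def by blast
  qed
  ultimately show ?thesis by (rule decomposable_iso)
qed

text \<open>Columns 0 and 1 are the row and column index, so a transversal design arises when the
  tables in \<open>T\<close> are mutually orthogonal Latin squares.\<close>

definition table_columns :: "nat list list list \<Rightarrow> nat \<Rightarrow> nat \<Rightarrow> nat \<Rightarrow> nat" where
  "table_columns T j x y = (if j = 0 then x else if j = 1 then y else T ! (j - 2) ! x ! y)"

lemma transversal_design_check:
  assumes "list_all (\<lambda>j. list_all (\<lambda>(x, y). f j x y < m) (List.product [0..<m] [0..<m])) [0..<k]"
    and "list_all (\<lambda>i. list_all (\<lambda>j. distinct (map (\<lambda>(x, y). (f i x y, f j x y))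
      (List.product [0..<m] [0..<m]))) [0..<i]) [0..<k]"
  shows "transversal_design k m f"
proof -
  have "inj_on (\<lambda>(x, y). (f i x y, f j x y)) ({..<m} \<times> {..<m})" if "i < k" "j < i" for i j
    using assms(2) that by (simp add: list_all_iff distinct_map atLeast0LessThan)
  then show ?thesis using assms(1) unfolding transversal_design_def by (simp add: list_all_iff)
qed

text \<open>The tables list \<open>x + s y\<close> over the field with \<open>m\<close> elements for several \<open>s\<close>.\<close>

lemma transversal_design_4: "\<exists>f. transversal_design 5 4 f"
  by (rule exI, rule transversal_design_check[where f = "table_columns
      [[[0, 1, 2, 3], [1, 0, 3, 2], [2, 3, 0, 1], [3, 2, 1, 0]], [[0, 2, 3, 1], [1, 3, 2,
      0], [2, 0, 1, 3], [3, 1, 0, 2]], [[0, 3, 1, 2], [1, 2, 0, 3], [2, 1, 3, 0], [3, 0, 2,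
      1]]]"]) code_simp+

lemma transversal_design_8: "\<exists>f. transversal_design 4 8 f"
  by (rule exI, rule transversal_design_check[where f = "table_columns
      [[[0, 1, 2, 3, 4, 5, 6, 7], [1, 0, 3, 2, 5, 4, 7, 6], [2, 3, 0, 1, 6, 7, 4, 5], [3,
      2, 1, 0, 7, 6, 5, 4], [4, 5, 6, 7, 0, 1, 2, 3], [5, 4, 7, 6, 1, 0, 3, 2], [6, 7, 4,
      5, 2, 3, 0, 1], [7, 6, 5, 4, 3, 2, 1, 0]], [[0, 2, 4, 6, 3, 1, 7, 5], [1, 3, 5, 7, 2,
      0, 6, 4], [2, 0, 6, 4, 1, 3, 5, 7], [3, 1, 7, 5, 0, 2, 4, 6], [4, 6, 0, 2, 7, 5, 3,
      1], [5, 7, 1, 3, 6, 4, 2, 0], [6, 4, 2, 0, 5, 7, 1, 3], [7, 5, 3, 1, 4, 6, 0, 2]]]"]) code_simp+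

lemma transversal_design_9: "\<exists>f. transversal_design 5 9 f"
  by (rule exI, rule transversal_design_check[where f = "table_columns
      [[[0, 1, 2, 3, 4, 5, 6, 7, 8], [1, 2, 0, 4, 5, 3, 7, 8, 6], [2, 0, 1, 5, 3, 4, 8, 6,
      7], [3, 4, 5, 6, 7, 8, 0, 1, 2], [4, 5, 3, 7, 8, 6, 1, 2, 0], [5, 3, 4, 8, 6, 7, 2,
      0, 1], [6, 7, 8, 0, 1, 2, 3, 4, 5], [7, 8, 6, 1, 2, 0, 4, 5, 3], [8, 6, 7, 2, 0, 1,
      5, 3, 4]], [[0, 3, 6, 2, 5, 8, 1, 4, 7], [1, 4, 7, 0, 3, 6, 2, 5, 8], [2, 5, 8, 1, 4,
      7, 0, 3, 6], [3, 6, 0, 5, 8, 2, 4, 7, 1], [4, 7, 1, 3, 6, 0, 5, 8, 2], [5, 8, 2, 4,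
      7, 1, 3, 6, 0], [6, 0, 3, 8, 2, 5, 7, 1, 4], [7, 1, 4, 6, 0, 3, 8, 2, 5], [8, 2, 5,
      7, 1, 4, 6, 0, 3]], [[0, 4, 8, 5, 6, 1, 7, 2, 3], [1, 5, 6, 3, 7, 2, 8, 0, 4], [2, 3,
      7, 4, 8, 0, 6, 1, 5], [3, 7, 2, 8, 0, 4, 1, 5, 6], [4, 8, 0, 6, 1, 5, 2, 3, 7], [5,
      6, 1, 7, 2, 3, 0, 4, 8], [6, 1, 5, 2, 3, 7, 4, 8, 0], [7, 2, 3, 0, 4, 8, 5, 6, 1],
      [8, 0, 4, 1, 5, 6, 3, 7, 2]]]"]) code_simp+

section \<open>The rook's graph\<close>

lemma rook_edge_iff:
  "{p, q} \<in> rook \<longleftrightarrow> p < 16 \<and> q < 16 \<and> p \<noteq> q \<and> (p div 4 = q div 4 \<or> p mod 4 = q mod 4)"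
  unfolding rook_def rook_arcs_def by (auto simp: doubleton_eq_iff)

lemma rookE:
  assumes "e \<in> rook"
  obtains p q where "e = {p, q}" "p < 16" "q < 16" "p \<noteq> q" "p div 4 = q div 4 \<or> p mod 4 = q mod 4"
  using assms unfolding rook_def rook_arcs_def by auto

text \<open>The cell in row \<open>i\<close> and column \<open>j\<close> becomes the edge joining
  left vertex \<open>i\<close> to right vertex \<open>j\<close>; a common row or column is then a
  common endpoint.\<close>

lemma rook_iso_LK44: "iso_edges rook LK44"
proof -
  let ?f = "\<lambda>p::nat. {Inl (p div 4), Inr (p mod 4)} :: (nat + nat) set"
  have f_inj: "?f p = ?f q \<longleftrightarrow> p = q" for p q
    by (auto simp: doubleton_eq_iff) (metis div_mult_mod_eq)
  have f_int: "?f p \<inter> ?f q \<noteq> {} \<longleftrightarrow> p div 4 = q div 4 \<or> p mod 4 = q mod 4" for p q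
    by auto
  have f_K44: "K44 = ?f ` {..<16}"
  proof (intro equalityI subsetI)
    fix e assume "e \<in> K44"
    then obtain i j where "e = {Inl i, Inr j}" "i < 4" "j < 4" unfolding K44_def by blast
    then show "e \<in> ?f ` {..<16}" by (intro image_eqI[of _ _ "4 * i + j"]) auto
  next
    fix e assume "e \<in> ?f ` {..<16}"
    then obtain p where p: "e = ?f p" "p < 16" by blast
    then have "p div 4 < 4" "p mod 4 < 4" by auto
    then show "e \<in> K44" unfolding K44_def using p(1) by blast
  qed
  have "inj_on ?f (\<Union>rook)" by (rule inj_onI) (simp only: f_inj)
  moreover have "LK44 = (\<lambda>e. ?f ` e) ` rook"
  proof (intro equalityI subsetI)
    fix z assume "z \<in> LK44"
    then obtain e f where "z = {e, f}" "e \<in> K44" "f \<in> K44" "e \<noteq> f" "e \<inter> f \<noteq> {}"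
      unfolding LK44_def line_graph_def by blast
    moreover then obtain p q where "e = ?f p" "f = ?f q" "p < 16" "q < 16" unfolding f_K44 by blast
    ultimately have "z = ?f ` {p, q}" "{p, q} \<in> rook" unfolding rook_edge_iff f_int by auto
    then show "z \<in> (\<lambda>e. ?f ` e) ` rook" by (rule image_eqI)
  next
    fix z assume "z \<in> (\<lambda>e. ?f ` e) ` rook"
    then obtain e where e: "e \<in> rook" "z = ?f ` e" by (elim imageE)
    from e(1) obtain p q where pq: "e = {p, q}" "p < 16" "q < 16" "p \<noteq> q"
      "p div 4 = q div 4 \<or> p mod 4 = q mod 4" by (rule rookE)
    have "z = {?f p, ?f q}" using e(2) pq(1) by simp
    moreover have "?f p \<in> K44" "?f q \<in> K44" unfolding f_K44 using pq by blast+
    moreover have "?f p \<noteq> ?f q" using pq(4) by (simp only: f_inj not_False_eq_True)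
    moreover have "?f p \<inter> ?f q \<noteq> {}" unfolding f_int by (rule pq(5))
    ultimately show "z \<in> LK44" unfolding LK44_def line_graph_def by (intro CollectI exI conjI)
  qed
  ultimately show ?thesis unfolding iso_edges_def by blast
qed

lemma complete_graph_clique: "complete_graph n = clique {..<n}"
  by (simp add: complete_graph_def clique_def)

section \<open>Necessity\<close>

lemma card_rook: "card rook = 48"
proof -
  \<comment> \<open>One orientation of each edge is kept, so edges are counted by evaluating a
    list.\<close>
  let ?L = "filter (\<lambda>(p, q). p < q) rook_arcs"
  have eq: "rook = (\<lambda>(p, q). {p, q}) ` set ?L"
  proof (intro equalityI subsetI)
    fix e assume "e \<in> rook"
    then obtain p q where e: "e = {p, q}" "(p, q) \<in> set rook_arcs" unfolding rook_def by blast
    show "e \<in> (\<lambda>(p, q). {p, q}) ` set ?L"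
    proof (cases "p < q")
      case True
      then show ?thesis using e by (intro image_eqI[of _ _ "(p, q)"]) auto
    next
      case False
      moreover have "p \<noteq> q" using e(2) unfolding rook_arcs_def by auto
      ultimately show ?thesis
        using e rook_arcs_sym[OF e(2)] by (intro image_eqI[of _ _ "(q, p)"]) auto
    qed
  next
    fix e assume "e \<in> (\<lambda>(p, q). {p, q}) ` set ?L"
    then show "e \<in> rook" unfolding rook_def by auto
  qed
  have "inj_on (\<lambda>(p, q). {p, q}) (set ?L)"
    by (auto simp: inj_on_def doubleton_eq_iff)
  then have "card rook = card (set ?L)" unfolding eq by (rule card_image)
  also have "\<dots> = length ?L"
    by (rule distinct_card) (simp add: rook_arcs_def distinct_product)
  also have "\<dots> = 48" by code_simp
  finally show ?thesis .
qed

lemma rook_degree: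
  assumes "p < 16"
  shows "card {e \<in> rook. p \<in> e} = 6"
proof -
  let ?L = "\<lambda>p. map snd (filter (\<lambda>a. fst a = p) rook_arcs)"
  have eq: "{e \<in> rook. p \<in> e} = (\<lambda>q. {p, q}) ` set (?L p)"
  proof (intro equalityI subsetI)
    fix e assume "e \<in> {e \<in> rook. p \<in> e}"
    then obtain a b where e: "e = {a, b}" "(a, b) \<in> set rook_arcs" "p = a \<or> p = b"
      unfolding rook_def by blast
    from e(3) have "\<exists>q. e = {p, q} \<and> (p, q) \<in> set rook_arcs"
    proof
      assume "p = a"
      then show ?thesis using e by blast
    next
      assume "p = b"
      then show ?thesis using e rook_arcs_sym[OF e(2)] by blast
    qed
    then obtain q where q: "e = {p, q}" "(p, q) \<in> set rook_arcs" by blast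
    then have "q \<in> set (?L p)" by force
    then show "e \<in> (\<lambda>q. {p, q}) ` set (?L p)" using q(1) by blast
  next
    fix e assume "e \<in> (\<lambda>q. {p, q}) ` set (?L p)"
    then obtain q where "e = {p, q}" "(p, q) \<in> set rook_arcs" by auto
    then show "e \<in> {e \<in> rook. p \<in> e}" unfolding rook_def by blast
  qed
  have "inj_on (\<lambda>q. {p, q}) (set (?L p))"
    by (auto simp: inj_on_def doubleton_eq_iff)
  then have "card {e \<in> rook. p \<in> e} = card (set (?L p))" unfolding eq by (rule card_image)
  also have "\<dots> = 6"
  proof -
    have "list_all (\<lambda>p. card (set (?L p)) = 6) [0..<16]" by code_simp
    then show ?thesis unfolding list_all_iff by (rule bspec) (use assms in simp)
  qed
  finally show ?thesis .
qed

text \<open>A vertex meets a copy in 6 edges if it belongs to it and in none otherwise; divisibility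
  by 6 covers both cases.\<close>

lemma rook_copy_card:
  assumes "iso_edges rook C"
  shows "finite C" "card C = 48" "6 dvd card {e \<in> C. v \<in> e}"
proof -
  obtain f where f: "inj_on f (\<Union>rook)" "C = (\<lambda>e. f ` e) ` rook"
    using assms unfolding iso_edges_def by blast
  have inj: "inj_on (\<lambda>e. f ` e) rook"
    using inj_on_image_Pow[OF f(1)] by (rule inj_on_subset) blast
  have fin: "finite rook" using card_rook by (metis card.infinite zero_neq_numeral)
  then show "finite C" using f(2) by simp
  show "card C = 48" using card_image[OF inj] f(2) card_rook by simp
  show "6 dvd card {e \<in> C. v \<in> e}"
  proof (cases "v \<in> f ` \<Union>rook")
    case True
    then obtain p where p: "v = f p" "p \<in> \<Union>rook" by blast
    from p(2) obtain d where d: "d \<in> rook" "p \<in> d" by (rule UnionE)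
    from d(1) obtain a b where ab: "d = {a, b}" "a < 16" "b < 16" by (rule rookE)
    have "p = a \<or> p = b" using d(2) unfolding ab(1) by simp
    then have "p < 16" using ab(2,3) by (elim disjE) simp_all
    have "v \<in> f ` e \<longleftrightarrow> p \<in> e" if "e \<in> rook" for e
    proof
      assume "v \<in> f ` e"
      then obtain q where q: "v = f q" "q \<in> e" by (rule imageE)
      then have "f p = f q" using p(1) by simp
      moreover have "q \<in> \<Union>rook" using that q(2) by (rule UnionI)
      ultimately have "p = q" using inj_onD[OF f(1)] p(2) by simp
      then show "p \<in> e" using q(2) by simp
    qed (use p in blast)
    then have eq: "{e \<in> C. v \<in> e} = (\<lambda>e. f ` e) ` {e \<in> rook. p \<in> e}" unfolding f(2) by auto
    have "inj_on (\<lambda>e. f ` e) {e \<in> rook. p \<in> e}" using inj by (rule inj_on_subset) blast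
    then have "card {e \<in> C. v \<in> e} = 6"
      unfolding eq using rook_degree[OF \<open>p < 16\<close>] by (simp add: card_image)
    then show ?thesis by simp
  next
    case False
    then have "{e \<in> C. v \<in> e} = {}" using f(2) by blast
    then show ?thesis by (simp only: card.empty dvd_0_right)
  qed
qed

lemma clique_degree:
  assumes "n > 0"
  shows "card {e \<in> clique {..<n}. 0 \<in> e} = n - 1"
proof -
  have "{e \<in> clique {..<n}. 0 \<in> e} = (\<lambda>q. {0, q}) ` {1..<n}"
  proof (intro equalityI subsetI)
    fix e assume "e \<in> {e \<in> clique {..<n}. 0 \<in> e}"
    then obtain u v where "e = {u, v}" "u < n" "v < n" "u \<noteq> v" "u = 0 \<or> v = 0"
      unfolding clique_def by blast
    then show "e \<in> (\<lambda>q. {0, q}) ` {1..<n}" by (auto simp: insert_commute)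
  next
    fix e assume "e \<in> (\<lambda>q. {0, q}) ` {1..<n}"
    then obtain q where "e = {0, q}" "1 \<le> q" "q < n" by auto
    then show "e \<in> {e \<in> clique {..<n}. 0 \<in> e}" using assms by (auto intro!: cliqueI)
  qed
  moreover have "inj_on (\<lambda>q. {0, q}) {1..<n}" by (auto simp: inj_on_def doubleton_eq_iff)
  ultimately show ?thesis by (simp add: card_image)
qed

lemma clique_2_subsets: "clique V = {e. e \<subseteq> V \<and> card e = 2}"
  unfolding clique_def by (auto simp: card_2_iff)

lemma card_clique: "card (clique {..<n}) = n choose 2"
  unfolding clique_2_subsets using n_subsets[of "{..<n}" 2] by simp

lemma rook_design_necessary:
  fixes n :: nat
  assumes dec: "decomposition (clique {..<n}) rook P" and n: "n > 0"
  shows "n mod 96 = 1"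
proof -
  have P: "\<Union>P = clique {..<n}"
    and disj: "\<And>C D. C \<in> P \<Longrightarrow> D \<in> P \<Longrightarrow> C \<noteq> D \<Longrightarrow> C \<inter> D = {}"
    and iso: "\<And>C. C \<in> P \<Longrightarrow> iso_edges rook C"
    using dec unfolding decomposition_def by auto
  have "clique {..<n} \<subseteq> Pow {..<n}" using clique_subset by blast
  then have finE: "finite (clique {..<n})" by (rule finite_subset) simp
  then have finP: "finite P" unfolding P[symmetric] by (rule finite_UnionD)
  have "n choose 2 = card (\<Union>P)" using P card_clique by simp
  also have "\<dots> = (\<Sum>C\<in>P. card C)"
    using disj rook_copy_card(1)[OF iso] by (intro card_Union_disjoint) (auto simp: pairwise_def disjnt_def)
  finally have "48 dvd n choose 2" using rook_copy_card(2)[OF iso] by simp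
  then have "2 * 48 dvd 2 * (n choose 2)" by (intro mult_dvd_mono) auto
  moreover have "2 * (n choose 2) = n * (n - 1)"
    unfolding choose_two by (rule dvd_mult_div_cancel) (cases n, auto)
  ultimately have e: "96 dvd n * (n - 1)" by simp
  \<comment> \<open>The degree of vertex 0 is distributed over the copies, each of which contributes
    a multiple of 6.\<close>
  have "n - 1 = card {e \<in> \<Union>P. 0 \<in> e}" using clique_degree[OF n] P by simp
  also have "{e \<in> \<Union>P. 0 \<in> e} = (\<Union>C\<in>P. {e \<in> C. 0 \<in> e})" by blast
  also have "card \<dots> = (\<Sum>C\<in>P. card {e \<in> C. 0 \<in> e})"
  proof (rule card_UN_disjoint[OF finP])
    show "\<forall>C\<in>P. finite {e \<in> C. 0 \<in> e}" using rook_copy_card(1)[OF iso] by simp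
    show "\<forall>C\<in>P. \<forall>D\<in>P. C \<noteq> D \<longrightarrow> {e \<in> C. 0 \<in> e} \<inter> {e \<in> D. 0 \<in> e} = {}"
      using disj by blast
  qed
  finally have "6 dvd n - 1" using rook_copy_card(3)[OF iso] by (simp add: dvd_sum)
  then obtain k where k: "n = 6 * k + 1" using n by (metis Suc_eq_plus1 Suc_pred' dvdE)
  \<comment> \<open>After cancelling 6, the factor \<open>6 * k + 1\<close> is odd and hence coprime
    to 16, so 16 divides \<open>k\<close>.\<close>
  have "6 * 16 dvd 6 * (k * (6 * k + 1))" using e unfolding k by (simp add: algebra_simps)
  then have "16 dvd k * (6 * k + 1)" by (subst (asm) dvd_times_left_cancel_iff) simp_all
  moreover have "coprime (2 ^ 4) (6 * k + 1)"
    unfolding coprime_power_left_iff by (simp add: coprime_left_2_iff_odd)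
  then have "coprime 16 (6 * k + 1)" by simp
  ultimately have "16 dvd k" using coprime_dvd_mult_left_iff by blast
  then show ?thesis unfolding k by (auto elim!: dvdE)
qed

section \<open>Sufficiency\<close>

text \<open>Row plus column modulo 4, the cyclic Latin square, is a proper colouring with four
  colours.\<close>

lemma rook_blow:
  assumes "transversal_design 4 m f"
  shows "decomposable rook (blow m rook)"
proof -
  have "(p div 4 + p mod 4) mod 4 \<noteq> (q div 4 + q mod 4) mod 4" if "(p, q) \<in> set rook_arcs" for p q
  proof -
    have "list_all (\<lambda>(p, q). (p div 4 + p mod 4) mod 4 \<noteq> (q div 4 + q mod 4) mod 4) rook_arcs"
      by code_simp
    then show ?thesis using that by (auto simp: list_all_iff)
  qed
  then show ?thesis unfolding rook_def
    using rook_arcs_sym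
    by (intro decomposable_blow_coloured[OF assms, where c = "\<lambda>p. (p div 4 + p mod 4) mod 4"]) auto
qed

text \<open>The given decomposition is blown up by \<open>m\<close>, and each blown-up rook's graph
  splits again.\<close>

lemma rook_blow_mult:
  assumes "decomposable rook (blow W E)" "\<exists>f. transversal_design 4 m f"
  shows "decomposable rook (blow (W * m) E)"
proof -
  obtain f where "transversal_design 4 m f" using assms(2) by blast
  then have "decomposable rook (blow m (blow W E))"
    using rook_blow decomposable_blow[OF assms(1)] decomposable_trans by blast
  then show ?thesis using blow_blow_iso decomposable_iso by blast
qed

lemma transversal_design_4_3: "\<exists>f. transversal_design 4 3 f"
proof -
  have "coprime d 3" if "0 < d" "d < 4 - 1" for d :: nat
  proof -
    have "d = 1 \<or> d = 2" using that by auto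
    then show ?thesis by auto
  qed
  then show ?thesis using transversal_design_linear[of 4 3, OF _ zero_less_numeral] by blast
qed

lemma transversal_design_4_4: "\<exists>f. transversal_design 4 4 f"
  using transversal_design_4 transversal_design_mono[of 5 4 _ 4] by auto

text \<open>Weight 4 comes from the affine plane, and factors 3, 4 and 8 are multiplied onto it.
  Order 2 has no pair of orthogonal Latin squares, so 32 is reached as \<open>4 * 8\<close>.
  Combined with group sizes 1, 2, 3 and 6 these weights give 96, 192 and 288.\<close>

lemma rook_blow_K4:
  shows "decomposable rook (blow 16 (clique {..<4::nat}))"
    and "decomposable rook (blow 32 (clique {..<4::nat}))"
    and "decomposable rook (blow 48 (clique {..<4::nat}))"
    and "decomposable rook (blow 64 (clique {..<4::nat}))"
    and "decomposable rook (blow 96 (clique {..<4::nat}))"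
    and "decomposable rook (blow 192 (clique {..<4::nat}))"
    and "decomposable rook (blow 288 (clique {..<4::nat}))"
proof -
  note td = transversal_design_4_3 transversal_design_4_4 transversal_design_8
  note step = rook_blow_mult[of _ "clique {..<4::nat}"]
  show 16: "decomposable rook (blow 16 (clique {..<4::nat}))" using step[OF rook_blow_4 td(2)] by simp
  show 32: "decomposable rook (blow 32 (clique {..<4::nat}))" using step[OF rook_blow_4 td(3)] by simp
  show 48: "decomposable rook (blow 48 (clique {..<4::nat}))" using step[OF 16 td(1)] by simp
  show "decomposable rook (blow 64 (clique {..<4::nat}))" using step[OF 16 td(2)] by simp
  show 96: "decomposable rook (blow 96 (clique {..<4::nat}))" using step[OF 32 td(1)] by simp
  show "decomposable rook (blow 192 (clique {..<4::nat}))" using step[OF 48 td(2)] by simp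
  show "decomposable rook (blow 288 (clique {..<4::nat}))" using step[OF 96 td(1)] by simp
qed

text \<open>Wilson's weighting: every point of a group divisible design gets weight
  \<open>W\<close>, and each block becomes a blow-up of the complete graph on four vertices.\<close>

lemma rook_blow_group_divisible:
  assumes "decomposable (clique {..<4::nat}) (blow g E)"
    and "decomposable rook (blow W (clique {..<4::nat}))"
  shows "decomposable rook (blow (g * W) E)"
  using decomposable_iso[OF decomposable_trans[OF assms(2) decomposable_blow[OF assms(1)]] blow_blow_iso] .

section \<open>Orders of the form 96t + 1\<close>

definition good :: "nat \<Rightarrow> bool" where
  "good t \<longleftrightarrow> decomposable rook (clique {..<96 * t + 1})"

text \<open>Each of the \<open>u\<close> vertices becomes a group of \<open>96 * t\<close> points,
  which the point at infinity completes to a clique of order \<open>96 * t + 1\<close>.\<close>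

lemma good_mult:
  assumes "decomposable rook (blow (96 * t) (clique {..<u::nat}))" "good t"
  shows "good (t * u)"
proof -
  have "decomposable rook (clique {..<96 * t * card {..<u} + 1})"
  proof (rule decomposable_fill[where g = "\<lambda>x. x"])
    show "decomposable rook (blow (96 * t) {{p, q} | p q. p \<in> {..<u} \<and> q \<in> {..<u} \<and> p \<noteq> q})"
      using assms(1) unfolding clique_def .
    fix i assume "i \<in> (\<lambda>x. x) ` {..<u}"
    then have "{p \<in> {..<u}. p = i} = {i}" by auto
    then show "decomposable rook (clique {..<96 * t * card {p \<in> {..<u}. p = i} + 1})"
      using assms(2) unfolding good_def by simp
  qed simp
  then show ?thesis unfolding good_def by (simp add: mult.assoc)
qed

text \<open>The affine plane of order 4 without one point is a group divisible design with five
  groups of size 3; weight 32 turns them into groups of size 96. This serves the blocks of size five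
  that survive truncation.\<close>

lemma rook_blow_K5: "decomposable rook (blow 96 (clique {..<5::nat}))"
  using rook_blow_group_divisible[OF K4_group_divisible_3_5 rook_blow_K4(2)] by simp

lemma good_truncated:
  assumes "\<exists>f. transversal_design 5 m f" "s \<le> m" "good m" "good s"
  shows "good (4 * m + s)"
  using assms decomposable_truncated rook_blow_K4(5) rook_blow_K5 unfolding good_def by blast

text \<open>The values below 16 start the recursion. The values 26 and 27 escape truncation, as they
  lie strictly between \<open>5 * 5\<close> and \<open>4 * 7\<close> and no transversal design of
  order 6 is at hand.\<close>

lemma good_small:
  assumes "t < 16 \<or> t = 26 \<or> t = 27"
  shows "good t"
proof -
  note gd = rook_blow_group_divisible
  \<comment> \<open>This is the graph on one vertex; the recursion meets it whenever the truncated
    group is empty.\<close>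
  have g0: "good 0" unfolding good_def
    using decomposable_empty[of rook] by (simp add: clique_def lessThan_Suc)
  have g1: "good 1" and g2: "good 2" and g3: "good 3" and g6: "good 6"
    unfolding good_def using rook_97 rook_193 rook_289 rook_577 by simp_all
  \<comment> \<open>From here \<open>good_mult\<close> is applied with first factor 1, 2 or 3; the
    total weight must be 96 times that factor, and it is the product of group size and weight where
    a group divisible design is used.\<close>
  have g4: "good 4" using good_mult[of 1 4] rook_blow_K4(5) g1 by simp
  have g8: "good 8" using good_mult[of 2 4] rook_blow_K4(6) g2 by simp
  have g12: "good 12" using good_mult[of 3 4] rook_blow_K4(7) g3 by simp
  have g5: "good 5" using good_mult[of 1 5] rook_blow_K5 g1 by simp
  have g10: "good 10" using good_mult[of 2 5] gd[OF K4_group_divisible_3_5 rook_blow_K4(4)] g2 by simp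
  have g15: "good 15" using good_mult[of 3 5] gd[OF K4_group_divisible_3_5 rook_blow_K4(5)] g3 by simp
  have g7: "good 7" using good_mult[of 1 7] gd[OF K4_group_divisible_2_7 rook_blow_K4(3)] g1 by simp
  have g14: "good 14" using good_mult[of 2 7] gd[OF K4_group_divisible_2_7 rook_blow_K4(5)] g2 by simp
  have g9: "good 9" using good_mult[of 1 9] gd[OF K4_group_divisible_6_9 rook_blow_K4(1)] g1 by simp
  have g27: "good 27" using good_mult[of 3 9] gd[OF K4_group_divisible_6_9 rook_blow_K4(3)] g3 by simp
  have g11: "good 11" using good_mult[of 1 11] gd[OF K4_group_divisible_6_11 rook_blow_K4(1)] g1 by simp
  have g13: "good 13" using good_mult[of 1 13] gd[OF K4_group_divisible_1_13 rook_blow_K4(5)] g1 by simp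
  have g26: "good 26" using good_mult[of 2 13] gd[OF K4_group_divisible_1_13 rook_blow_K4(6)] g2 by simp
  have "t \<in> {0, 1, 2, 3, 4, 5, 6, 7, 8, 9, 10, 11, 12, 13, 14, 15, 26, 27}"
    using assms by (simp, presburger)
  then show ?thesis
    using g0 g1 g2 g3 g4 g5 g6 g7 g8 g9 g10 g11 g12 g13 g14 g15 g26 g27 by blast
qed

text \<open>Orders coprime to 6 admit the linear construction, where the slope differences are 1, 2
  and 3. Order 16 is the product of order 4 with itself.\<close>

lemma transversal_design_5:
  assumes "m mod 6 = 1 \<or> m mod 6 = 5 \<or> m = 4 \<or> m = 9 \<or> m = 16"
  shows "\<exists>f. transversal_design 5 m f"
proof (cases "m mod 6 = 1 \<or> m mod 6 = 5")
  case True
  have "coprime 2 m" "coprime 3 m"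
  proof -
    have "odd m" and "m mod 3 = 1 \<or> m mod 3 = 2" using True by presburger+
    show "coprime 2 m" using \<open>odd m\<close> by (simp add: coprime_left_2_iff_odd)
    have "coprime 3 (m mod 3)"
      using \<open>m mod 3 = 1 \<or> m mod 3 = 2\<close>
      by (elim disjE; simp only: coprime_1_right coprime_right_2_iff_odd) simp
    then show "coprime 3 m" by simp
  qed
  then have "coprime d m" if "0 < d" "d < 5 - 1" for d
  proof -
    have "d = 1 \<or> d = 2 \<or> d = 3" using that by auto
    then show ?thesis using \<open>coprime 2 m\<close> \<open>coprime 3 m\<close> by auto
  qed
  moreover have "m > 0" using True by (cases m) auto
  ultimately show ?thesis using transversal_design_linear[of 5 m] by blast
next
  case False
  have "\<exists>f. transversal_design 5 (4 * 4) f"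
    using transversal_design_4 transversal_design_product by blast
  then show ?thesis using False assms transversal_design_4 transversal_design_9 by auto
qed

text \<open>The intervals from \<open>4 * m\<close> to \<open>5 * m\<close> have to cover every
  remaining \<open>t\<close>. Below 72 the listed choices of \<open>m\<close> do so; beyond that,
  the gaps between numbers coprime to 6 are too small to leave holes.\<close>

lemma truncation_parameters:
  fixes t :: nat
  assumes "t \<ge> 16" "t \<noteq> 26" "t \<noteq> 27"
  obtains m where "m mod 6 = 1 \<or> m mod 6 = 5 \<or> m = 4 \<or> m = 9 \<or> m = 16" "4 * m \<le> t" "t \<le> 5 * m"
proof (cases "t < 72")
  case True
  consider "t \<le> 20" | "20 < t" "t \<le> 25" | "28 \<le> t" "t \<le> 35" | "36 \<le> t" "t \<le> 45"
    | "45 < t" "t \<le> 55" | "55 < t" "t \<le> 65" | "65 < t" "t < 72"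
    using assms True by linarith
  then show thesis
  proof cases
    case 1 then show ?thesis using that[of 4] assms by simp
  next
    case 2 then show ?thesis using that[of 5] by simp
  next
    case 3 then show ?thesis using that[of 7] by simp
  next
    case 4 then show ?thesis using that[of 9] by simp
  next
    case 5 then show ?thesis using that[of 11] by simp
  next
    case 6 then show ?thesis using that[of 13] by simp
  next
    case 7 then show ?thesis using that[of 16] by simp
  qed
next
  case False
  define q where "q = t div 4"
  have q: "4 * q \<le> t" "t \<le> 4 * q + 3" "q \<ge> 18" using False unfolding q_def by auto
  have "\<exists>m. (m mod 6 = 1 \<or> m mod 6 = 5) \<and> m \<le> q \<and> q \<le> m + 3"
  proof -
    define r where "r = q div 6"
    have r: "q = 6 * r + q mod 6" unfolding r_def by simp
    have "q mod 6 < 6" by simp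
    then consider "q mod 6 = 0" | "1 \<le> q mod 6" "q mod 6 \<le> 4" | "q mod 6 = 5" by linarith
    then show ?thesis
    proof cases
      case 1
      then have "r = Suc (r - 1)" using r q(3) by linarith
      then have "q = 6 * (r - 1) + 6" using r 1 by linarith
      then show ?thesis by (intro exI[of _ "6 * (r - 1) + 5"]) simp
    next
      case 2
      then show ?thesis using r by (intro exI[of _ "6 * r + 1"]) simp
    next
      case 3
      then show ?thesis by (intro exI[of _ q]) simp
    qed
  qed
  then obtain m where "m mod 6 = 1 \<or> m mod 6 = 5" "m \<le> q" "q \<le> m + 3" by blast
  \<comment> \<open>From \<open>q \<ge> 18\<close> follows \<open>m \<ge> 15\<close>, hence
    \<open>t \<le> 4 * q + 3 \<le> 4 * m + 15 \<le> 5 * m\<close>.\<close>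
  then show thesis using that[of m] q by auto
qed

lemma good_all: "good t"
proof (induction t rule: less_induct)
  case (less t)
  show ?case
  proof (cases "t < 16 \<or> t = 26 \<or> t = 27")
    case False
    then obtain m where m: "m mod 6 = 1 \<or> m mod 6 = 5 \<or> m = 4 \<or> m = 9 \<or> m = 16"
      "4 * m \<le> t" "t \<le> 5 * m"
      using truncation_parameters[of t] by auto
    \<comment> \<open>Both \<open>m\<close> and \<open>t - 4 * m\<close> are smaller than
      \<open>t\<close>, and \<open>t \<le> 5 * m\<close> bounds the truncated group by
      \<open>m\<close>.\<close>
    have "good (4 * m + (t - 4 * m))"
      using m False by (intro good_truncated transversal_design_5 less.IH) auto
    then show ?thesis using m by simp
  qed (rule good_small)
qed

theorem theorem3p1:
  fixes n :: nat
  assumes "n > 0"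
  shows "has_design LK44 n \<longleftrightarrow> n mod 96 = 1"
proof
  assume "has_design LK44 n"
  then obtain P where "decomposition (clique {..<n}) LK44 P"
    unfolding has_design_def complete_graph_clique by blast
  then have "decomposition (clique {..<n}) rook P"
    using iso_edges_trans[OF rook_iso_LK44, of C for C :: "nat set set"] by (simp add: decomposition_def)
  then show "n mod 96 = 1" using assms by (rule rook_design_necessary)
next
  assume "n mod 96 = 1"
  then have "96 * (n div 96) + 1 = n" by (metis mult_div_mod_eq)
  then have "decomposable rook (clique {..<n})" using good_all[of "n div 96"] unfolding good_def by simp
  \<comment> \<open>The rook's graph is itself a single copy of \<open>LK44\<close>, so transitivity
    replaces one by the other.\<close>
  then have "decomposable LK44 (clique {..<n})"
    by (rule decomposable_trans[OF decomposable_iso_self[OF iso_edges_sym[OF rook_iso_LK44]]])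
  then show "has_design LK44 n"
    unfolding has_design_def decomposable_def complete_graph_clique .
qed

end
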